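(* Let $R$ be a ring of characteristic $p>0$, $I\subseteq R$ an ideal, and $s\geq 1$ a rational number. Then $I^*+I_s\subseteq I^{\{s\}}$, where $I_s$ is the $s$th rational power of $I$. Furthermore, equality $I^*+I_s=I^{\{s\}}$ holds if $R$ is a polynomial ring or an affine semigroup ring over a field and $I$ is a monomial ideal of $R$.
   Context: All rings are commutative and noetherian. $R^\circ$ denotes the set of elements of $R$ lying in no minimal prime of $R$. The letter $q$ denotes positive integer powers of $p$, and $q\gg 0$ means all sufficiently large such powers. $I^{[q]}=(f^q\mid f\in I)$ is the $q$th Frobenius power of $I$. The tight closure $I^*$ is the set of $x\in R$ for which there is $c\in R^\circ$ with $cx^q\in I^{[q]}$ for all $q\gg 0$. For a real number $s\geq 1$, $I^{(s,q)}=I^{\lceil sq\rceil}+I^{[q]}$, and the weak $s$-closure $I^{\{s\}}$ is the ideal of all $x\in R$ for which there exists $c\in R^\circ$ such that $cx^q\in I^{(s,q)}$ for all $q\gg 0$. For a rational number $\alpha\geq 0$, the $\alpha$th rational power $I_\alpha$ is the set of all $x\in R$ such that $x^b\in\overline{I^a}$ (integral closure), where $\alpha=a/b$ with $a,b\in\mathbb{N}$, $b>0$; this does not depend on the choice of representation $a/b$. An affine semigroup ring over a field $k$ is $k[S]$ for $S$ a finitely generated submonoid of some $\mathbb{Z}^n$; a monomial ideal is one generated by monomials (elements of $S$, respectively monomials in the variables). *)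

theory Defs
  imports
    Complex_Main
    "HOL-Computational_Algebra.Primes"
    "HOL-Library.Poly_Mapping"
    "HOL-Algebra.Algebra"
begin

section \<open>Closure operations on ideals\<close>

text \<open>The kernel of \<open>\<int> \<rightarrow> R\<close> is generated by \<open>p\<close>.\<close>

definition has_characteristic :: "('a, 'm) ring_scheme \<Rightarrow> nat \<Rightarrow> bool" where
  "has_characteristic R p \<longleftrightarrow> (\<forall>n::nat. add_pow R n \<one>\<^bsub>R\<^esub> = \<zero>\<^bsub>R\<^esub> \<longleftrightarrow> p dvd n)"

definition minimal_primes :: "('a, 'm) ring_scheme \<Rightarrow> 'a set set" where
  "minimal_primes R =
     {P. primeideal P R \<and> (\<forall>Q. primeideal Q R \<longrightarrow> Q \<subseteq> P \<longrightarrow> Q = P)}"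

text \<open>The set \<open>R\<^sup>\<circ>\<close>.\<close>

definition off_minimal_primes :: "('a, 'm) ring_scheme \<Rightarrow> 'a set" where
  "off_minimal_primes R = carrier R - \<Union> (minimal_primes R)"

definition ideal_power :: "('a, 'm) ring_scheme \<Rightarrow> 'a set \<Rightarrow> nat \<Rightarrow> 'a set" where
  "ideal_power R I n = I [^]\<^bsub>ideals_set R\<^esub> n"

definition frobenius_power :: "('a, 'm) ring_scheme \<Rightarrow> 'a set \<Rightarrow> nat \<Rightarrow> 'a set" where
  "frobenius_power R I q = Idl\<^bsub>R\<^esub> ((\<lambda>f. f [^]\<^bsub>R\<^esub> q) ` I)"

definition integral_closure :: "('a, 'm) ring_scheme \<Rightarrow> 'a set \<Rightarrow> 'a set" where
  "integral_closure R I =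
     {x \<in> carrier R. \<exists>n>0. \<exists>a. (\<forall>i\<in>{1..n}. a i \<in> ideal_power R I i) \<and>
        x [^]\<^bsub>R\<^esub> n \<oplus>\<^bsub>R\<^esub> (\<Oplus>\<^bsub>R\<^esub>i\<in>{1..n}. a i \<otimes>\<^bsub>R\<^esub> x [^]\<^bsub>R\<^esub> (n - i)) = \<zero>\<^bsub>R\<^esub>}"

text \<open>In the next two definitions \<open>q\<close> is \<open>p ^ e\<close>, so ``for all \<open>q \<gg> 0\<close>'' is
  ``for all large \<open>e\<close>''.\<close>

definition tight_closure :: "('a, 'm) ring_scheme \<Rightarrow> nat \<Rightarrow> 'a set \<Rightarrow> 'a set" where
  "tight_closure R p I =
     {x \<in> carrier R. \<exists>c\<in>off_minimal_primes R.
        \<forall>\<^sub>F e in sequentially. c \<otimes>\<^bsub>R\<^esub> x [^]\<^bsub>R\<^esub> (p ^ e) \<in> frobenius_power R I (p ^ e)}"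

definition mixed_power :: "('a, 'm) ring_scheme \<Rightarrow> 'a set \<Rightarrow> real \<Rightarrow> nat \<Rightarrow> 'a set" where
  "mixed_power R I s q =
     ideal_power R I (nat \<lceil>s * real q\<rceil>) <+>\<^bsub>R\<^esub> frobenius_power R I q"

definition weak_closure :: "('a, 'm) ring_scheme \<Rightarrow> nat \<Rightarrow> real \<Rightarrow> 'a set \<Rightarrow> 'a set" where
  "weak_closure R p s I =
     {x \<in> carrier R. \<exists>c\<in>off_minimal_primes R.
        \<forall>\<^sub>F e in sequentially. c \<otimes>\<^bsub>R\<^esub> x [^]\<^bsub>R\<^esub> (p ^ e) \<in> mixed_power R I s (p ^ e)}"

definition rational_power :: "('a, 'm) ring_scheme \<Rightarrow> 'a set \<Rightarrow> rat \<Rightarrow> 'a set" where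
  "rational_power R I \<alpha> =
     {x \<in> carrier R. \<exists>a b :: nat. b > 0 \<and> \<alpha> = of_nat a / of_nat b \<and>
        x [^]\<^bsub>R\<^esub> b \<in> integral_closure R (ideal_power R I a)}"


section \<open>Affine semigroup rings\<close>

text \<open>The vectors with all coordinates of index at least \<open>n\<close> equal to zero: this is
  \<open>\<int>\<^sup>n\<close> for \<open>'c = int\<close>, and \<open>\<nat>\<^sup>n\<close>, the exponents of the monomials in \<open>n\<close> variables,
  for \<open>'c = nat\<close>.\<close>

definition coordinate_vectors :: "nat \<Rightarrow> (nat \<Rightarrow>\<^sub>0 'c::zero) set" where
  "coordinate_vectors n = {v. Poly_Mapping.keys v \<subseteq> {..<n}}"

definition additive_submonoid :: "'g::comm_monoid_add set \<Rightarrow> bool" where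
  "additive_submonoid S \<longleftrightarrow> 0 \<in> S \<and> (\<forall>u\<in>S. \<forall>v\<in>S. u + v \<in> S)"

definition affine_semigroup :: "nat \<Rightarrow> (nat \<Rightarrow>\<^sub>0 int) set \<Rightarrow> bool" where
  "affine_semigroup n S \<longleftrightarrow>
     (\<exists>A. finite A \<and> A \<subseteq> coordinate_vectors n \<and> S = additive_submonoid hull A)"

text \<open>Multiplication on \<open>'g \<Rightarrow>\<^sub>0 'k\<close> is convolution, so this is \<open>k[S]\<close> if \<open>S\<close> is a
  submonoid.\<close>

definition semigroup_ring :: "'g::comm_monoid_add set \<Rightarrow> ('g \<Rightarrow>\<^sub>0 'k::field) ring" where
  "semigroup_ring S =
     \<lparr> carrier = {f. Poly_Mapping.keys f \<subseteq> S}, monoid.mult = (*), one = 1,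
       ring.zero = 0, add = (+) \<rparr>"

text \<open>Here \<open>h\<close> is meant to be an isomorphism from \<open>k[S]\<close> to \<open>R\<close>; the monomials of \<open>R\<close>
  are the images of the elements of \<open>S\<close>.\<close>

definition monomial_ideal ::
    "('a, 'm) ring_scheme \<Rightarrow> 'g::comm_monoid_add set \<Rightarrow> (('g \<Rightarrow>\<^sub>0 'k::field) \<Rightarrow> 'a) \<Rightarrow> 'a set \<Rightarrow> bool"
  where
  "monomial_ideal R S h I \<longleftrightarrow>
     (\<exists>M\<subseteq>S. I = Idl\<^bsub>R\<^esub> ((\<lambda>v. h (Poly_Mapping.single v 1)) ` M))"

end

theory Submission
  imports Defs
begin

text \<open>
The inclusion \<open>I\<^sup>* + I\<^sub>s \<subseteq> I\<^bsup>{s}\<^esup>\<close>. The weak closure contains the tight closure since its defining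
ideals are larger, and it is closed under addition since the Frobenius map is additive. For
\<open>x \<in> I\<^sub>s\<close>, an equation of integral dependence for \<open>x\<^sup>b\<close> over \<open>I\<^sup>a\<close> gives \<open>x\<^sup>n \<in> I\<^bsup>sn-D\<^esup>\<close> for all \<open>n\<close>
with a constant \<open>D\<close> (\<open>rational_power_bounded_deficiency\<close>). It remains to absorb \<open>D\<close> into a multiplier
\<open>c\<close> outside all minimal primes. If \<open>I\<close> has an element outside all minimal primes, its \<open>D\<close>th power
does it; in general the multiplier is assembled from one term per minimal prime
(\<open>absorb_bounded_deficiency\<close>), which uses that there are finitely many of them and that the elements
of their intersection are nilpotent.

The reverse inclusion for monomial ideals. Let \<open>R = k[S]\<close> and \<open>x \<in> I\<^bsup>{s}\<^esup>\<close>, say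
\<open>c x\<^sup>q \<in> I\<^bsup>(s,q)\<^esup>\<close> for large \<open>q\<close>. The support of \<open>x\<^sup>q\<close> consists of the multiples \<open>q v\<close> with \<open>v\<close> in the
support of \<open>x\<close>, and for large \<open>q\<close> the products with the monomials of \<open>c\<close> do not cancel. So for one
exponent \<open>u\<close> of \<open>c\<close> and every \<open>v\<close>, the monomial \<open>u + q v\<close> lies in \<open>I\<^bsup>(s,q)\<^esup>\<close>, that is, in the
Frobenius power or in the ordinary power (\<open>weak_closure_exponents\<close>). Write it as a sum of
generators of \<open>I\<close> and of \<open>S\<close>. By Dickson's lemma, two of these representations, for \<open>q < q'\<close> of the
same kind, are comparable. Their difference represents \<open>(q' - q) v\<close>, without \<open>u\<close>
(\<open>exponent_dichotomy\<close>).

If this happens for the Frobenius powers, then \<open>N v = N g + w\<close> with a generator \<open>g\<close> of \<open>I\<close>, \<open>w \<in> S\<close> and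
\<open>N > 0\<close>. Then \<open>q v + N g \<in> q g + S\<close> for all \<open>q\<close>, and the monomial is in \<open>I\<^sup>*\<close>. If it happens for the
ordinary powers, then with \<open>s = a / b\<close> and \<open>q \<equiv> q'\<close> modulo \<open>b\<close> the multiple \<open>b N v\<close> is an
exponent of \<open>I\<^bsup>aN\<^esup>\<close>, and the monomial is in \<open>I\<^sub>s\<close>.
Tight closure is closed under addition. That a sum of monomials of the second kind is again in \<open>I\<^sub>s\<close> is \<open>sum_in_rational_power\<close>, by the criterion
\<open>integral_if_faithful_module\<close>, proved here by elimination in place of determinants.
\<close>

section \<open>Powers of ideals\<close>

context cring
begin

lemma monoid_ideals_set: "monoid (ideals_set R)"
  using ideals_set_is_comm_monoid comm_monoid.axioms(1) by blast

lemma ideal_power_0 [simp]: "ideal_power R I 0 = carrier R"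
  unfolding ideal_power_def by (simp add: nat_pow_def ideals_set_def)

lemma ideal_power_Suc: "ideal_power R I (Suc n) = ideal_prod R (ideal_power R I n) I"
  unfolding ideal_power_def by (simp add: nat_pow_def ideals_set_def)

lemma ideal_power_ideal: "ideal I R \<Longrightarrow> ideal (ideal_power R I n) R"
  by (induction n) (auto simp: ideal_power_Suc oneideal ideal_prod_is_ideal)

lemma ideal_power_1: "ideal I R \<Longrightarrow> ideal_power R I 1 = I"
  using ideal_prod_commute[of I "carrier R"] 
  by (simp add: ideal_power_Suc oneideal ideal_prod_one)

lemma ideal_power_add:
  assumes "ideal I R"
  shows "ideal_prod R (ideal_power R I m) (ideal_power R I n) = ideal_power R I (m + n)"
  using monoid.nat_pow_mult[OF monoid_ideals_set, of I m n] assms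
  unfolding ideal_power_def by (simp add: ideals_set_def)

lemma ideal_power_power:
  assumes "ideal I R"
  shows "ideal_power R (ideal_power R I m) n = ideal_power R I (m * n)"
  using monoid.nat_pow_pow[OF monoid_ideals_set, of I m n] assms
  unfolding ideal_power_def by (simp add: ideals_set_def)

lemma ideal_power_mult_mem:
  assumes "ideal I R" "x \<in> ideal_power R I m" "y \<in> ideal_power R I n"
  shows "x \<otimes> y \<in> ideal_power R I (m + n)"
  using ideal_prod.prod[OF assms(2,3), of R] ideal_power_add[OF assms(1)] by blast

lemma ideal_power_antimono:
  assumes "ideal I R" "m \<le> n"
  shows "ideal_power R I n \<subseteq> ideal_power R I m"
proof -
  have "ideal_power R I n = ideal_prod R (ideal_power R I m) (ideal_power R I (n - m))"
    using assms by (simp add: ideal_power_add)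
  then show ?thesis
    using ideal_prod_inter[of "ideal_power R I m" "ideal_power R I (n - m)"]
      ideal_power_ideal[OF assms(1)] by blast
qed

lemma ideal_power_mem_antimono:
  "ideal I R \<Longrightarrow> x \<in> ideal_power R I n \<Longrightarrow> m \<le> n \<Longrightarrow> x \<in> ideal_power R I m"
  using ideal_power_antimono by blast

lemma ideal_power_carrier: "ideal I R \<Longrightarrow> x \<in> ideal_power R I n \<Longrightarrow> x \<in> carrier R"
  using ideal_power_ideal ideal.Icarr by metis

lemma pow_mem_ideal_power:
  assumes "ideal I R" "x \<in> ideal_power R I m"
  shows "x [^] (n::nat) \<in> ideal_power R I (m * n)"
proof (induction n)
  case (Suc n)
  show ?case
    using ideal_power_mult_mem[OF assms(1) Suc assms(2)] by (simp add: add.commute)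
qed simp

lemma ideal_finsum_closed:
  assumes "ideal I R" "\<And>i. i \<in> F \<Longrightarrow> f i \<in> I"
  shows "finsum R f F \<in> I"
proof (cases "finite F")
  case True
  then show ?thesis using assms(2)
  proof (induction F rule: finite_induct)
    case empty
    then show ?case
      using assms(1) by (simp add: additive_subgroup.zero_closed ideal.axioms(1))
  next
    case (insert a F)
    have "finsum R f (insert a F) = f a \<oplus> finsum R f F"
      using insert ideal.Icarr[OF assms(1)] by (intro finsum_insert) auto
    with insert show ?case
      by (simp add: additive_subgroup.a_closed[OF ideal.axioms(1)[OF assms(1)]])
  qed
next
  case False
  then show ?thesis
    using assms(1) by (simp add: finsum_infinite additive_subgroup.zero_closed ideal.axioms(1))
qed

lemma ideal_diff_closed:
  assumes "ideal I R" "x \<in> I" "y \<in> I"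
  shows "x \<ominus> y \<in> I"
  using additive_subgroup.a_closed[OF ideal.axioms(1)[OF assms(1)] assms(2)]
    additive_subgroup.a_inv_closed[OF ideal.axioms(1)[OF assms(1)] assms(3)]
  by (simp add: a_minus_def)

section \<open>The Frobenius endomorphism\<close>

text \<open>The binomial theorem for a ring given by its carrier; it yields additivity of the Frobenius
map, which makes both closures closed under addition.\<close>

lemma binomial_expansion:
  assumes [simp]: "x \<in> carrier R" "y \<in> carrier R"
  shows "(x \<oplus> y) [^] (n::nat)
    = (\<Oplus>k\<in>{..n}. add_pow R (n choose k) (x [^] k \<otimes> y [^] (n - k)))"
proof (induction n)
  case 0
  then show ?case by simp
next
  case (Suc n)
  let ?t = "\<lambda>n k. add_pow R (n choose k) (x [^] k \<otimes> y [^] (n - k))"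
  have t: "?t n k \<in> carrier R" for n k by simp
  let ?f = "\<lambda>k. add_pow R (n choose k) (x [^] Suc k \<otimes> y [^] (n - k))"
  let ?g = "\<lambda>k. add_pow R (n choose Suc k) (x [^] Suc k \<otimes> y [^] (n - k))"
  have "(x \<oplus> y) [^] Suc n = (\<Oplus>k\<in>{..n}. ?t n k) \<otimes> x \<oplus> (\<Oplus>k\<in>{..n}. ?t n k) \<otimes> y"
    using Suc by (simp add: r_distr finsum_closed)
  also have "(\<Oplus>k\<in>{..n}. ?t n k) \<otimes> x = (\<Oplus>k\<in>{..n}. ?f k)"
    by (subst finsum_ldistr) (auto intro!: finsum_cong' simp: add_pow_ldistr add_pow_rdistr m_ac)
  also have "(\<Oplus>k\<in>{..n}. ?t n k) \<otimes> y = (\<Oplus>k\<in>{..n}. add_pow R (n choose k) (x [^] k \<otimes> y [^] (Suc n - k)))"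
    by (subst finsum_ldistr) (auto intro!: finsum_cong' simp: add_pow_ldistr add_pow_rdistr m_ac Suc_diff_le)
  also have "\<dots> = (\<Oplus>k\<in>{..Suc n}. add_pow R (n choose k) (x [^] k \<otimes> y [^] (Suc n - k)))"
    by (subst finsum_Suc) (auto simp: binomial_eq_0)
  also have "\<dots> = (\<Oplus>k\<in>{..n}. ?g k) \<oplus> y [^] Suc n"
    by (subst finsum_Suc2) (auto simp del: nat_pow_Suc)
  also have "(\<Oplus>k\<in>{..n}. ?f k) \<oplus> ((\<Oplus>k\<in>{..n}. ?g k) \<oplus> y [^] Suc n)
    = (\<Oplus>k\<in>{..n}. ?f k \<oplus> ?g k) \<oplus> y [^] Suc n"
    by (subst finsum_addf) (auto simp: a_assoc simp del: nat_pow_Suc)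
  also have "(\<Oplus>k\<in>{..n}. ?f k \<oplus> ?g k) = (\<Oplus>k\<in>{..n}. ?t (Suc n) (Suc k))"
    by (intro finsum_cong') (auto simp: add.nat_pow_mult simp del: nat_pow_Suc)
  also have "\<dots> \<oplus> y [^] Suc n = (\<Oplus>k\<in>{..Suc n}. ?t (Suc n) k)"
    by (subst finsum_Suc2) (auto simp del: nat_pow_Suc)
  finally show ?case .
qed

lemma frobenius_add_prime:
  assumes p: "Factorial_Ring.prime p" "has_characteristic R p"
    and [simp]: "x \<in> carrier R" "y \<in> carrier R"
  shows "(x \<oplus> y) [^] p = x [^] p \<oplus> y [^] p"
proof -
  let ?t = "\<lambda>k. add_pow R (p choose k) (x [^] k \<otimes> y [^] (p - k))"
  obtain m where m: "p = Suc m" "0 < m"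
    using prime_gt_1_nat[OF p(1)] by (metis Suc_lessE One_nat_def)
  have char: "add_pow R n z = \<zero>" if "p dvd n" "z \<in> carrier R" for n z
  proof -
    have "add_pow R n \<one> \<otimes> z = add_pow R n (\<one> \<otimes> z)"
      using that(2) by (intro add_pow_ldistr) auto
    moreover have "add_pow R n \<one> = \<zero>" using p(2) that(1) by (simp add: has_characteristic_def)
    ultimately show ?thesis using that(2) by simp
  qed
  have mid: "?t k = \<zero>" if "0 < k" "k < p" for k
    using dvd_choose_prime[OF _ _ _ p(1), of k] that by (intro char) auto
  have "(x \<oplus> y) [^] p = (\<Oplus>k\<in>{..p}. ?t k)" by (rule binomial_expansion) auto
  also have "\<dots> = ?t p \<oplus> (\<Oplus>k\<in>{..m}. ?t k)"
    unfolding m(1) by (subst finsum_Suc) (auto simp del: nat_pow_Suc)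
  also have "(\<Oplus>k\<in>{..m}. ?t k) = (\<Oplus>k\<in>{..m}. if 0 = k then y [^] p else \<zero>)"
    using m mid by (intro finsum_cong') (auto simp del: nat_pow_Suc)
  also have "\<dots> = y [^] p"
    by (subst finsum_singleton) auto
  finally show ?thesis by simp
qed

lemma frobenius_add:
  assumes p: "Factorial_Ring.prime p" "has_characteristic R p"
    and [simp]: "x \<in> carrier R" "y \<in> carrier R"
  shows "(x \<oplus> y) [^] (p ^ e) = x [^] (p ^ e) \<oplus> y [^] (p ^ e)"
proof (induction e)
  case (Suc e)
  have "(x \<oplus> y) [^] (p ^ Suc e) = ((x \<oplus> y) [^] (p ^ e)) [^] p"
    by (simp add: nat_pow_pow mult.commute)
  also have "\<dots> = (x [^] (p ^ e)) [^] p \<oplus> (y [^] (p ^ e)) [^] p"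
    using Suc by (simp add: frobenius_add_prime[OF p])
  finally show ?case by (simp add: nat_pow_pow mult.commute)
qed simp

lemma frobenius_finsum:
  assumes p: "Factorial_Ring.prime p" "has_characteristic R p"
    and "finite F" "\<And>i. i \<in> F \<Longrightarrow> f i \<in> carrier R"
  shows "(\<Oplus>i\<in>F. f i) [^] (p ^ e) = (\<Oplus>i\<in>F. f i [^] (p ^ e))"
  using assms(3,4)
proof (induction F rule: finite_induct)
  case empty
  have "0 < p ^ e" using prime_gt_0_nat[OF p(1)] by simp
  then show ?case by (simp add: nat_pow_zero)
next
  case (insert a F)
  then show ?case by (simp add: frobenius_add[OF p] Pi_iff)
qed

end

section \<open>Noetherian rings and their minimal primes\<close>

lemma (in primeideal) pow_notin:
  assumes "a \<in> carrier R" "a \<notin> I"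
  shows "a [^] (n::nat) \<notin> I"
proof (induction n)
  case 0
  then show ?case using I_notcarr one_imp_carrier by auto
next
  case (Suc n)
  then show ?case using I_prime[of "a [^] n" a] assms by auto
qed

locale noetherian_cring = noetherian_ring + cring
begin

lemma finite_subset_generates:
  assumes B: "B \<subseteq> carrier R"
  shows "\<exists>C\<subseteq>B. finite C \<and> Idl C = Idl B"
proof -
  \<comment> \<open>A maximal member exists among the ideals generated by finite subsets, and it must contain all generators.\<close>
  define \<F> where "\<F> = {Idl C | C. C \<subseteq> B \<and> finite C}"
  have "\<exists>M\<in>\<F>. \<forall>Y\<in>\<F>. M \<subseteq> Y \<longrightarrow> Y = M"
  proof (rule subset_Zorn_nonempty)
    show "\<F> \<noteq> {}" unfolding \<F>_def by blast
    fix C assume C: "C \<noteq> {}" "subset.chain \<F> C"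
    have "\<F> \<subseteq> {I. ideal I R}" unfolding \<F>_def using B genideal_ideal by blast
    then have "subset.chain {I. ideal I R} C" using C(2) by (auto simp: pred_on.chain_def)
    then have "\<Union>C \<in> C" using ideal_chain_is_trivial C(1) by blast
    then show "\<Union>C \<in> \<F>" using C(2) by (auto simp: pred_on.chain_def)
  qed
  then obtain M where M: "M \<in> \<F>" "\<And>Y. Y \<in> \<F> \<Longrightarrow> M \<subseteq> Y \<Longrightarrow> Y = M" by blast
  then obtain C where C: "C \<subseteq> B" "finite C" "M = Idl C" unfolding \<F>_def by blast
  have "B \<subseteq> Idl C"
  proof
    fix x assume x: "x \<in> B"
    have i: "insert x C \<subseteq> carrier R" using C(1) x B by blast
    have "Idl C \<subseteq> Idl (insert x C)" using subset_Idl_subset[OF i] by blast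
    moreover have "Idl (insert x C) \<in> \<F>" unfolding \<F>_def using C(1,2) x by blast
    ultimately have "Idl (insert x C) = Idl C" using M(2) C(3) by blast
    then show "x \<in> Idl C" using genideal_self[OF i] by blast
  qed
  then have "Idl B \<subseteq> Idl C" using genideal_minimal genideal_ideal C(1) B by (metis order_trans)
  moreover have "Idl C \<subseteq> Idl B" using subset_Idl_subset[OF B C(1)] .
  ultimately show ?thesis using C(1,2) by blast
qed

text \<open>Noetherian induction: a maximal counterexample \<open>M\<close> is neither the whole ring nor prime, so
\<open>a b \<in> M\<close> for some \<open>a, b \<notin> M\<close>, and the union of the families for \<open>M + (a)\<close> and
\<open>M + (b)\<close> works for \<open>M\<close>. Besides finiteness of the set of minimal primes this gives
that an element of all of them is nilpotent.\<close>

lemma finite_primes_below: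
  assumes "ideal J R"
  shows "\<exists>\<Q>. finite \<Q> \<and> (\<forall>P\<in>\<Q>. primeideal P R)
    \<and> (\<forall>Q. primeideal Q R \<longrightarrow> J \<subseteq> Q \<longrightarrow> (\<exists>P\<in>\<Q>. P \<subseteq> Q))
    \<and> (\<forall>z\<in>carrier R. (\<forall>P\<in>\<Q>. z \<in> P) \<longrightarrow> (\<exists>m::nat. z [^] m \<in> J))"
    (is "?good J")
proof (rule ccontr)
  assume "\<not> ?good J"
  define bad where "bad = {J. ideal J R \<and> \<not> ?good J}"
  have "\<exists>M\<in>bad. (\<forall>Y\<in>bad. (M \<subseteq> Y \<longrightarrow> Y = M))"
  proof (rule subset_Zorn_nonempty)
    have "J \<in> bad" unfolding bad_def by (intro CollectI conjI assms \<open>\<not> ?good J\<close>)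
    then show "bad \<noteq> {}" by blast
    fix C assume C: "C \<noteq> {}" "subset.chain bad C"
    then have "subset.chain {I. ideal I R} C"
      by (auto simp: pred_on.chain_def bad_def)
    then have "\<Union>C \<in> C" using ideal_chain_is_trivial C(1) by blast
    then show "\<Union>C \<in> bad" using C(2) by (auto simp: pred_on.chain_def)
  qed
  then obtain M where "M \<in> bad" and max: "\<And>Y. Y \<in> bad \<Longrightarrow> M \<subseteq> Y \<Longrightarrow> Y = M" by blast
  then have M: "ideal M R" "\<not> ?good M" by (auto simp: bad_def)
  interpret M: ideal M R by fact
  have "M \<noteq> carrier R"
  proof
    assume "M = carrier R"
    then have "?good M"
      by (intro exI[of _ "{}"])
        (auto dest: primeideal.I_notcarr ideal.Icarr primeideal.axioms(1))
    with M(2) show False by blast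
  qed
  moreover have "\<not> primeideal M R"
  proof
    assume "primeideal M R"
    then have "?good M"
      by (intro exI[of _ "{M}"]) (auto intro!: exI[of _ "1::nat"])
    with M(2) show False by blast
  qed
  ultimately obtain a b where ab: "a \<in> carrier R" "b \<in> carrier R" "a \<otimes> b \<in> M" "a \<notin> M" "b \<notin> M"
    using primeidealI[OF M(1) is_cring] by metis
  have larger: "?good (M <+>\<^bsub>R\<^esub> PIdl a) \<and> ideal (M <+>\<^bsub>R\<^esub> PIdl a) R" if "a \<in> carrier R" "a \<notin> M" for a
  proof -
    have i: "ideal (M <+>\<^bsub>R\<^esub> PIdl a) R" by (intro add_ideals M cgenideal_ideal that)
    have "M \<subseteq> M <+>\<^bsub>R\<^esub> PIdl a"
    proof
      fix m assume "m \<in> M"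
      then have "m \<oplus> \<zero> \<in> M <+>\<^bsub>R\<^esub> PIdl a"
        using additive_subgroup.zero_closed[OF ideal.axioms(1)[OF cgenideal_ideal[OF that(1)]]]
        unfolding set_add_def' by blast
      then show "m \<in> M <+>\<^bsub>R\<^esub> PIdl a" using \<open>m \<in> M\<close> by simp
    qed
    moreover have "a \<in> M <+>\<^bsub>R\<^esub> PIdl a"
    proof -
      have "\<zero> \<oplus> a \<in> M <+>\<^bsub>R\<^esub> PIdl a"
        using cgenideal_self[OF that(1)] M.zero_closed unfolding set_add_def' by blast
      then show ?thesis using that(1) by simp
    qed
    ultimately have "M <+>\<^bsub>R\<^esub> PIdl a \<notin> bad" using max that(2) by blast
    then show ?thesis using i unfolding bad_def by blast
  qed
  obtain \<Q>1 where Q1: "finite \<Q>1" "\<forall>P\<in>\<Q>1. primeideal P R"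
    "\<forall>Q. primeideal Q R \<longrightarrow> M <+>\<^bsub>R\<^esub> PIdl a \<subseteq> Q \<longrightarrow> (\<exists>P\<in>\<Q>1. P \<subseteq> Q)"
    "\<forall>z\<in>carrier R. (\<forall>P\<in>\<Q>1. z \<in> P) \<longrightarrow> (\<exists>m::nat. z [^] m \<in> M <+>\<^bsub>R\<^esub> PIdl a)"
    using larger[OF ab(1,4)] by blast
  obtain \<Q>2 where Q2: "finite \<Q>2" "\<forall>P\<in>\<Q>2. primeideal P R"
    "\<forall>Q. primeideal Q R \<longrightarrow> M <+>\<^bsub>R\<^esub> PIdl b \<subseteq> Q \<longrightarrow> (\<exists>P\<in>\<Q>2. P \<subseteq> Q)"
    "\<forall>z\<in>carrier R. (\<forall>P\<in>\<Q>2. z \<in> P) \<longrightarrow> (\<exists>m::nat. z [^] m \<in> M <+>\<^bsub>R\<^esub> PIdl b)"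
    using larger[OF ab(2,5)] by blast
  have sum_sub: "M <+>\<^bsub>R\<^esub> PIdl a \<subseteq> Q" if "primeideal Q R" "M \<subseteq> Q" "a \<in> Q" for Q a
  proof -
    interpret Q: primeideal Q R by fact
    have "PIdl a \<subseteq> Q" using that(3) by (intro cgenideal_minimal Q.is_ideal)
    then show ?thesis using that(2) Q.a_closed by (auto simp: set_add_def')
  qed
  have "?good M"
  proof (intro exI[of _ "\<Q>1 \<union> \<Q>2"] conjI allI impI ballI)
    show "finite (\<Q>1 \<union> \<Q>2)" using Q1(1) Q2(1) by blast
    show "primeideal P R" if "P \<in> \<Q>1 \<union> \<Q>2" for P using that Q1(2) Q2(2) by blast
    show "\<exists>P\<in>\<Q>1 \<union> \<Q>2. P \<subseteq> Q" if Q: "primeideal Q R" "M \<subseteq> Q" for Q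
    proof -
      have "a \<in> Q \<or> b \<in> Q" using primeideal.I_prime[OF Q(1) ab(1,2)] ab(3) Q(2) by blast
      then show ?thesis
      proof
        assume "a \<in> Q"
        then obtain P where "P \<in> \<Q>1" "P \<subseteq> Q" using sum_sub[OF Q] Q(1) Q1(3) by metis
        then show ?thesis by blast
      next
        assume "b \<in> Q"
        then obtain P where "P \<in> \<Q>2" "P \<subseteq> Q" using sum_sub[OF Q] Q(1) Q2(3) by metis
        then show ?thesis by blast
      qed
    qed
    fix z assume z: "z \<in> carrier R" "\<forall>P\<in>\<Q>1 \<union> \<Q>2. z \<in> P"
    obtain m1 :: nat where "z [^] m1 \<in> M <+>\<^bsub>R\<^esub> PIdl a" using Q1(4) z by blast
    then obtain i r where ir: "i \<in> M" "r \<in> carrier R" "z [^] m1 = i \<oplus> r \<otimes> a"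
      by (auto simp: set_add_def' cgenideal_def)
    obtain m2 :: nat where "z [^] m2 \<in> M <+>\<^bsub>R\<^esub> PIdl b" using Q2(4) z by blast
    then obtain j t where jt: "j \<in> M" "t \<in> carrier R" "z [^] m2 = j \<oplus> t \<otimes> b"
      by (auto simp: set_add_def' cgenideal_def)
    have c: "i \<in> carrier R" "j \<in> carrier R" using ir(1) jt(1) M.Icarr by auto
    have "z [^] (m1 + m2) = z [^] m1 \<otimes> z [^] m2" using z(1) by (simp add: nat_pow_mult)
    also have "\<dots> = i \<otimes> (j \<oplus> t \<otimes> b) \<oplus> ((r \<otimes> a) \<otimes> j \<oplus> (r \<otimes> t) \<otimes> (a \<otimes> b))"
      unfolding ir(3) jt(3) using c ir(2) jt(2) ab(1,2) by (simp add: l_distr r_distr m_ac a_ac)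
    also have "\<dots> \<in> M"
      using c ir(1,2) jt(1,2) ab(1-3)
      by (intro M.a_closed) (auto intro!: M.I_r_closed[OF ir(1)] M.I_l_closed)
    finally show "\<exists>m::nat. z [^] m \<in> M" by blast
  qed
  with M(2) show False by blast
qed

lemma finite_minimal_primes: "finite (minimal_primes R)"
  and nilpotent_if_in_minimal_primes:
    "z \<in> carrier R \<Longrightarrow> (\<And>P. P \<in> minimal_primes R \<Longrightarrow> z \<in> P) \<Longrightarrow> \<exists>m::nat. z [^] m = \<zero>"
proof -
  obtain \<Q> where Q: "finite \<Q>" "\<forall>P\<in>\<Q>. primeideal P R"
    "\<forall>Q. primeideal Q R \<longrightarrow> {\<zero>} \<subseteq> Q \<longrightarrow> (\<exists>P\<in>\<Q>. P \<subseteq> Q)"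
    "\<forall>z\<in>carrier R. (\<forall>P\<in>\<Q>. z \<in> P) \<longrightarrow> (\<exists>m::nat. z [^] m \<in> {\<zero>})"
    using finite_primes_below[OF zeroideal] by metis
  have below: "\<exists>P\<in>\<Q>. P \<subseteq> Q" if "primeideal Q R" for Q
    using Q(3) that
    by (simp add: additive_subgroup.zero_closed ideal.axioms(1) primeideal.axioms(1))
  have "minimal_primes R \<subseteq> \<Q>"
    
    using below Q(2) unfolding minimal_primes_def by (metis (mono_tags, lifting) mem_Collect_eq subsetI)
  then show "finite (minimal_primes R)" using Q(1) finite_subset by blast
  have minimal: "\<exists>P\<in>minimal_primes R. P \<subseteq> Q" if Q': "primeideal Q R" for Q
  proof -
    obtain P where P: "P \<in> {P\<in>\<Q>. P \<subseteq> Q}" "\<And>P'. P' \<in> {P\<in>\<Q>. P \<subseteq> Q} \<Longrightarrow> P' \<subseteq> P \<Longrightarrow> P = P'"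
      using finite_has_minimal[of "{P\<in>\<Q>. P \<subseteq> Q}"] below[OF Q'] Q(1) by auto
    have "P \<in> minimal_primes R"
      unfolding minimal_primes_def
    proof (intro CollectI conjI allI impI)
      show "primeideal P R" using P(1) Q(2) by blast
      fix Q' assume Q': "primeideal Q' R" "Q' \<subseteq> P"
      then obtain P' where "P' \<in> \<Q>" "P' \<subseteq> Q'" using below by blast
      then show "Q' = P" using P Q' by blast
    qed
    then show ?thesis using P(1) by blast
  qed
  show "\<exists>m::nat. z [^] m = \<zero>"
    if z: "z \<in> carrier R" "\<And>P. P \<in> minimal_primes R \<Longrightarrow> z \<in> P"
  proof -
    have "\<forall>P\<in>\<Q>. z \<in> P" using minimal Q(2) z(2) by blast
    then show ?thesis using Q(4) z(1) by blast
  qed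
qed

lemma minimal_primesD: "P \<in> minimal_primes R \<Longrightarrow> primeideal P R"
  by (simp add: minimal_primes_def)

text \<open>A product of elements chosen outside \<open>P\<close>, one from each of the other ideals. Such an \<open>e\<close>
replaces prime avoidance: a sum of one such element per minimal prime lies in no
minimal prime.\<close>

lemma exists_in_others_not_in:
  assumes "primeideal P R" "finite \<Q>" "\<And>Q. Q \<in> \<Q> \<Longrightarrow> ideal Q R \<and> \<not> Q \<subseteq> P"
  shows "\<exists>e\<in>carrier R - P. \<forall>Q\<in>\<Q>. e \<in> Q"
  using assms(2,3)
proof (induction \<Q> rule: finite_induct)
  case empty
  interpret primeideal P R by fact
  show ?case using I_notcarr one_imp_carrier by auto
next
  case (insert Q \<Q>)
  interpret primeideal P R by fact
  obtain e where e: "e \<in> carrier R - P" "\<forall>Q\<in>\<Q>. e \<in> Q" using insert by blast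
  obtain f where f: "f \<in> Q" "f \<notin> P" using insert.prems by blast
  have Q: "ideal Q R" using insert.prems by blast
  have fc: "f \<in> carrier R" using ideal.Icarr[OF Q f(1)] .
  have "e \<otimes> f \<in> carrier R - P" using e(1) f(2) fc I_prime by auto
  moreover have "e \<otimes> f \<in> Q" using ideal.I_l_closed[OF Q f(1)] e(1) by blast
  moreover have "e \<otimes> f \<in> Q'" if "Q' \<in> \<Q>" for Q'
    using ideal.I_r_closed[of Q' R e f] that insert.prems e(2) fc by blast
  ultimately show ?case by (intro bexI[of _ "e \<otimes> f"]) auto
qed

lemma minimal_prime_separator:
  assumes "P \<in> minimal_primes R"
  shows "\<exists>e\<in>carrier R - P. \<forall>Q\<in>minimal_primes R - {P}. e \<in> Q"
  using assms finite_minimal_primes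
  by (intro exists_in_others_not_in minimal_primesD)
    (auto simp: minimal_primes_def dest: primeideal.axioms(1))

lemma off_minimal_primes_sum:
  assumes "\<And>P. P \<in> minimal_primes R \<Longrightarrow> c P \<in> carrier R - P"
    and "\<And>P Q. P \<in> minimal_primes R \<Longrightarrow> Q \<in> minimal_primes R \<Longrightarrow> Q \<noteq> P \<Longrightarrow> c P \<in> Q"
  shows "(\<Oplus>P\<in>minimal_primes R. c P) \<in> off_minimal_primes R"
proof -
  have "(\<Oplus>P\<in>minimal_primes R. c P) \<notin> Q" if Q: "Q \<in> minimal_primes R" for Q
  proof
    assume a: "(\<Oplus>P\<in>minimal_primes R. c P) \<in> Q"
    interpret Q: primeideal Q R using minimal_primesD[OF Q] .
    let ?r = "\<Oplus>P\<in>minimal_primes R - {Q}. c P"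
    have r: "?r \<in> Q" using assms(2) Q by (intro ideal_finsum_closed Q.is_ideal) auto
    have "(\<Oplus>P\<in>insert Q (minimal_primes R - {Q}). c P) = c Q \<oplus> ?r"
      using assms(1) Q finite_minimal_primes by (intro finsum_insert) auto
    then have "(\<Oplus>P\<in>minimal_primes R. c P) = c Q \<oplus> ?r" using Q by (simp add: insert_absorb)
    then have "c Q \<oplus> ?r \<ominus> ?r \<in> Q" using ideal_diff_closed[OF Q.is_ideal a r] by simp
    moreover have "c Q \<oplus> ?r \<ominus> ?r = c Q"
      using assms(1)[OF Q] Q.Icarr[OF r] by (simp add: a_minus_def a_assoc r_neg)
    ultimately show False using assms(1)[OF Q] by simp
  qed
  moreover have "(\<Oplus>P\<in>minimal_primes R. c P) \<in> carrier R"
    using assms(1) by (intro finsum_closed) auto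
  ultimately show ?thesis unfolding off_minimal_primes_def by blast
qed

lemma off_minimal_primes_mult:
  assumes "a \<in> off_minimal_primes R" "b \<in> off_minimal_primes R"
  shows "a \<otimes> b \<in> off_minimal_primes R"
  using assms primeideal.I_prime[OF minimal_primesD, of _ a b]
  unfolding off_minimal_primes_def by blast

text \<open>The multiplier \<open>c\<close> is a sum of one term for each minimal prime \<open>P\<close>, lying outside \<open>P\<close> but inside
all other minimal primes. If \<open>I\<close> is not contained in \<open>P\<close>, the term contains the \<open>D\<close>th power of an
element of \<open>I\<close>, which makes up for the missing \<open>D\<close>. If \<open>I \<subseteq> P\<close>, then \<open>x \<in> P\<close> and the term
can be chosen to annihilate all high powers of \<open>x\<close>.\<close>

lemma absorb_bounded_deficiency:
  assumes I: "ideal I R" and x: "x \<in> carrier R"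
    and defic: "\<And>n. x [^] n \<in> ideal_power R I (f n - D)"
    and k: "x [^] (k::nat) \<in> I"
  shows "\<exists>c\<in>off_minimal_primes R. \<exists>N. \<forall>n\<ge>N. c \<otimes> x [^] (n::nat) \<in> ideal_power R I (f n)"
proof -
  have "\<exists>c N. c \<in> carrier R - P \<and> (\<forall>Q\<in>minimal_primes R. Q \<noteq> P \<longrightarrow> c \<in> Q)
      \<and> (\<forall>n\<ge>N. c \<otimes> x [^] n \<in> ideal_power R I (f n))" if P: "P \<in> minimal_primes R" for P
  proof -
    interpret P: primeideal P R using minimal_primesD[OF P] .
    obtain e where e: "e \<in> carrier R - P" "\<And>Q. Q\<in>minimal_primes R - {P} \<Longrightarrow> e \<in> Q"
      using minimal_prime_separator[OF P] by blast
    show ?thesis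
    proof (cases "I \<subseteq> P")
      case True
      have "x \<in> P" using P.pow_notin[OF x] k True by blast
      have "e \<otimes> x \<in> Q" if Q: "Q \<in> minimal_primes R" for Q
      proof -
        interpret Q: primeideal Q R using minimal_primesD[OF Q] .
        show ?thesis
          using e(1) e(2)[of Q] Q Q.I_l_closed[of x e] Q.I_r_closed[of e x] \<open>x \<in> P\<close> x
          by (cases "Q = P") auto
      qed
      then obtain m :: nat where m: "(e \<otimes> x) [^] m = \<zero>"
        using nilpotent_if_in_minimal_primes[of "e \<otimes> x"] e(1) x by auto
      have c: "e [^] Suc m \<otimes> x [^] n \<in> ideal_power R I (f n)" if "m \<le> n" for n
      proof -
        have "e [^] Suc m \<otimes> x [^] (m + (n - m)) = (e \<otimes> x) [^] m \<otimes> (e \<otimes> x [^] (n - m))"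
          using e(1) x by (simp add: nat_pow_mult[symmetric] nat_pow_distrib m_ac)
        also have "\<dots> = \<zero>" using m e(1) x by simp
        finally show ?thesis
          using that ideal_power_ideal[OF I] by (simp add: additive_subgroup.zero_closed ideal.axioms(1))
      qed
      have "e [^] Suc m \<in> carrier R - P" using P.pow_notin[of e "Suc m"] e(1) by auto
      moreover have "e [^] Suc m \<in> Q" if "Q \<in> minimal_primes R" "Q \<noteq> P" for Q
        using ideal.I_l_closed[OF primeideal.axioms(1)[OF minimal_primesD[OF that(1)]], of e "e [^] m"]
          e that by auto
      ultimately show ?thesis using c by blast
    next
      case False
      then obtain i where i: "i \<in> I" "i \<notin> P" by blast
      have ic: "i \<in> carrier R" using ideal.Icarr[OF I i(1)] .
      have c: "e \<otimes> i [^] D \<otimes> x [^] n \<in> ideal_power R I (f n)" for n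
      proof -
        have "i [^] D \<in> ideal_power R I D"
          using pow_mem_ideal_power[OF I, of i 1 D] i(1) by (simp add: ideal_power_1[OF I, simplified])
        from ideal_power_mult_mem[OF I this defic[of n]]
        have "i [^] D \<otimes> x [^] n \<in> ideal_power R I (f n)"
          using ideal_power_antimono[OF I, of "f n" "D + (f n - D)"] by (simp add: subset_iff)
        from ideal.I_l_closed[OF ideal_power_ideal[OF I] this, of e]
        show ?thesis using e(1) ic x by (simp add: m_assoc)
      qed
      have "e \<otimes> i [^] D \<in> carrier R - P"
        using P.pow_notin[OF ic i(2)] P.I_prime[of e "i [^] D"] e(1) ic by auto
      moreover have "e \<otimes> i [^] D \<in> Q" if "Q \<in> minimal_primes R" "Q \<noteq> P" for Q
        using ideal.I_r_closed[OF primeideal.axioms(1)[OF minimal_primesD[OF that(1)]], of e "i [^] D"]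
          e that ic by auto
      ultimately show ?thesis using c by blast
    qed
  qed
  then obtain c N where c: "\<And>P. P \<in> minimal_primes R \<Longrightarrow> c P \<in> carrier R - P"
    "\<And>P Q. P \<in> minimal_primes R \<Longrightarrow> Q \<in> minimal_primes R \<Longrightarrow> Q \<noteq> P \<Longrightarrow> c P \<in> Q"
    "\<And>P n. P \<in> minimal_primes R \<Longrightarrow> N P \<le> n \<Longrightarrow> c P \<otimes> x [^] n \<in> ideal_power R I (f n)"
    by metis
  have "(\<Oplus>P\<in>minimal_primes R. c P) \<otimes> x [^] n \<in> ideal_power R I (f n)"
    if n: "(\<Sum>P\<in>minimal_primes R. N P) \<le> n" for n
  proof -
    have "N P \<le> n" if "P \<in> minimal_primes R" for P
      using member_le_sum[of P "minimal_primes R" N] that finite_minimal_primes n by simp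
    then have "(\<Oplus>P\<in>minimal_primes R. c P \<otimes> x [^] n) \<in> ideal_power R I (f n)"
      using c(3) by (intro ideal_finsum_closed ideal_power_ideal I) auto
    moreover have "(\<Oplus>P\<in>minimal_primes R. c P) \<otimes> x [^] n = (\<Oplus>P\<in>minimal_primes R. c P \<otimes> x [^] n)"
      using c(1) x by (intro finsum_ldistr finite_minimal_primes) auto
    ultimately show ?thesis by simp
  qed
  with off_minimal_primes_sum[OF c(1,2)] show ?thesis by blast
qed

end

section \<open>The inclusion for arbitrary ideals\<close>

context cring
begin

text \<open>The equation expresses \<open>y\<^sup>n\<close> by terms \<open>a\<^sub>i y\<^bsup>n-i\<^esup>\<close> with \<open>a\<^sub>i \<in> J\<^sup>i\<close>, so no step of the recursion
loses more than what the start loses: the defect stays at most the degree \<open>d\<close>.\<close>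

lemma integral_imp_bounded_deficiency:
  assumes J: "ideal J R" and y: "y \<in> integral_closure R J"
  shows "\<exists>d. \<forall>n. y [^] n \<in> ideal_power R J (n - d)"
proof -
  obtain d a where yc: "y \<in> carrier R"
    and a: "\<And>i. i \<in> {1..d} \<Longrightarrow> a i \<in> ideal_power R J i"
    and eq: "y [^] d \<oplus> (\<Oplus>i\<in>{1..d}. a i \<otimes> y [^] (d - i)) = \<zero>" (is "_ \<oplus> ?s = _")
    using y unfolding integral_closure_def by blast
  have ac: "a i \<in> carrier R" if "i \<in> {1..d}" for i
    using ideal_power_carrier[OF J] a[OF that] .
  have "y [^] n \<in> ideal_power R J (n - d)" for n
  proof (induction n rule: less_induct)
    case (less n)
    show ?case
    proof (cases "n < d")
      case True
      then show ?thesis using yc by simp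
    next
      case False
      have s: "?s \<in> carrier R" using ac yc by (intro finsum_closed) auto
      have "y [^] n = y [^] d \<otimes> y [^] (n - d)" using False yc by (simp add: nat_pow_mult)
      also have "y [^] d = \<ominus> ?s" using eq s yc minus_equality by fastforce
      also have "\<ominus> ?s \<otimes> y [^] (n - d) = \<ominus> (\<Oplus>i\<in>{1..d}. a i \<otimes> y [^] (n - i))"
      proof -
        have "?s \<otimes> y [^] (n - d) = (\<Oplus>i\<in>{1..d}. (a i \<otimes> y [^] (d - i)) \<otimes> y [^] (n - d))"
          using ac yc by (intro finsum_ldistr) auto
        also have "\<dots> = (\<Oplus>i\<in>{1..d}. a i \<otimes> y [^] (n - i))"
          using ac yc False by (intro finsum_cong') (auto simp: m_assoc nat_pow_mult)
        finally show ?thesis using s yc by (simp add: l_minus)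
      qed
      also have "\<dots> \<in> ideal_power R J (n - d)"
      proof (intro additive_subgroup.a_inv_closed[OF ideal.axioms(1)] ideal_finsum_closed
          ideal_power_ideal J)
        fix i assume i: "i \<in> {1..d}"
        have "a i \<otimes> y [^] (n - i) \<in> ideal_power R J (i + (n - i - d))"
          using i False by (intro ideal_power_mult_mem J a less) auto
        then show "a i \<otimes> y [^] (n - i) \<in> ideal_power R J (n - d)"
          by (rule ideal_power_mem_antimono[OF J]) simp
      qed
      finally show ?thesis .
    qed
  qed
  then show ?thesis by blast
qed

text \<open>Writing \<open>n = b (n div b) + n mod b\<close> transfers the bound from the powers of \<open>x\<^sup>b\<close> to those of \<open>x\<close>;
the rounding costs another \<open>a\<close>.\<close>

lemma rational_power_bounded_deficiency:
  assumes I: "ideal I R" and x: "x \<in> rational_power R I s"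
  shows "\<exists>D. \<forall>n. x [^] n \<in> ideal_power R I (nat \<lceil>real_of_rat s * real n\<rceil> - D)"
proof -
  obtain a b :: nat where xc: "x \<in> carrier R" and b: "b > 0" and s: "s = of_nat a / of_nat b"
    and int: "x [^] b \<in> integral_closure R (ideal_power R I a)"
    using x unfolding rational_power_def by blast
  obtain d where d: "\<And>n. (x [^] b) [^] n \<in> ideal_power R (ideal_power R I a) (n - d)"
    using integral_imp_bounded_deficiency[OF ideal_power_ideal[OF I] int] by blast
  have "x [^] n \<in> ideal_power R I (nat \<lceil>real_of_rat s * real n\<rceil> - a * (d + 1))" for n
  proof -
    have "(x [^] b) [^] (n div b) \<in> ideal_power R I (a * (n div b - d))"
      using d[of "n div b"] ideal_power_power[OF I] by simp
    then have "(x [^] b) [^] (n div b) \<otimes> x [^] (n mod b) \<in> ideal_power R I (a * (n div b - d))"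
      using xc by (intro ideal.I_r_closed[OF ideal_power_ideal[OF I]]) auto
    moreover have "(x [^] b) [^] (n div b) \<otimes> x [^] (n mod b) = x [^] n"
      using xc by (simp add: nat_pow_pow nat_pow_mult)
    moreover have "nat \<lceil>real_of_rat s * real n\<rceil> - a * (d + 1) \<le> a * (n div b - d)"
    proof -
      have "n \<le> b * (n div b + 1)" using b by (simp add: dividend_less_times_div less_imp_le)
      then have "real n \<le> real b * (real (n div b) + 1)"
        by (metis of_nat_1 of_nat_add of_nat_le_iff of_nat_mult)
      then have "real a * real n \<le> real a * (real b * (real (n div b) + 1))"
        by (intro mult_left_mono) auto
      then have "real_of_rat s * real n \<le> real a * (real (n div b) + 1)"
        using b by (simp add: s of_rat_divide field_simps)
      then have "nat \<lceil>real_of_rat s * real n\<rceil> \<le> a * (n div b + 1)"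
        by (metis ceiling_le_iff nat_le_iff of_int_of_nat_eq of_nat_1 of_nat_add of_nat_mult)
      also have "\<dots> \<le> a * ((n div b - d) + (d + 1))" by (intro mult_left_mono) auto
      finally show ?thesis by (simp only: distrib_left)
    qed
    ultimately show ?thesis using ideal_power_antimono[OF I] by (metis subsetD)
  qed
  then show ?thesis by blast
qed

lemma frobenius_power_ideal: "ideal I R \<Longrightarrow> ideal (frobenius_power R I q) R"
  unfolding frobenius_power_def by (intro genideal_ideal) (auto dest: ideal.Icarr)

lemma mixed_power_ideal: "ideal I R \<Longrightarrow> ideal (mixed_power R I s q) R"
  unfolding mixed_power_def
  by (intro add_ideals ideal_power_ideal frobenius_power_ideal)

lemma ideal_power_subset_mixed_power:
  assumes "ideal I R"
  shows "ideal_power R I (nat \<lceil>s * real q\<rceil>) \<subseteq> mixed_power R I s q"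
proof
  fix x assume x: "x \<in> ideal_power R I (nat \<lceil>s * real q\<rceil>)"
  have "\<zero> \<in> frobenius_power R I q"
    using frobenius_power_ideal[OF assms] by (simp add: additive_subgroup.zero_closed ideal.axioms(1))
  then have "x \<oplus> \<zero> \<in> mixed_power R I s q"
    using x unfolding mixed_power_def set_add_def' by blast
  then show "x \<in> mixed_power R I s q" using ideal_power_carrier[OF assms x] by simp
qed

lemma frobenius_power_subset_mixed_power:
  assumes "ideal I R"
  shows "frobenius_power R I q \<subseteq> mixed_power R I s q"
proof
  fix x assume x: "x \<in> frobenius_power R I q"
  have "\<zero> \<in> ideal_power R I (nat \<lceil>s * real q\<rceil>)"
    using ideal_power_ideal[OF assms] by (simp add: additive_subgroup.zero_closed ideal.axioms(1))
  then have "\<zero> \<oplus> x \<in> mixed_power R I s q"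
    using x unfolding mixed_power_def set_add_def' by blast
  then show "x \<in> mixed_power R I s q"
    using ideal.Icarr[OF frobenius_power_ideal[OF assms] x] by simp
qed

lemma tight_closure_subset_weak_closure:
  assumes "ideal I R"
  shows "tight_closure R p I \<subseteq> weak_closure R p s I"
  using frobenius_power_subset_mixed_power[OF assms]
  unfolding tight_closure_def weak_closure_def
  by (fastforce elim: eventually_mono)

end

context noetherian_cring
begin

lemma frobenius_closure_add:
  assumes p: "Factorial_Ring.prime p" "has_characteristic R p"
    and K: "\<And>e. ideal (K e) R"
    and x: "x \<in> carrier R" "c \<in> off_minimal_primes R" "\<forall>\<^sub>F e in sequentially. c \<otimes> x [^] (p ^ e) \<in> K e"
    and y: "y \<in> carrier R" "d \<in> off_minimal_primes R" "\<forall>\<^sub>F e in sequentially. d \<otimes> y [^] (p ^ e) \<in> K e"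
  shows "\<exists>c\<in>off_minimal_primes R. \<forall>\<^sub>F e in sequentially. c \<otimes> (x \<oplus> y) [^] (p ^ e) \<in> K e"
proof (intro bexI[of _ "c \<otimes> d"] off_minimal_primes_mult x(2) y(2))
  have cd: "c \<in> carrier R" "d \<in> carrier R"
    using x(2) y(2) by (auto simp: off_minimal_primes_def)
  show "\<forall>\<^sub>F e in sequentially. c \<otimes> d \<otimes> (x \<oplus> y) [^] (p ^ e) \<in> K e"
    using x(3) y(3)
  proof eventually_elim
    case (elim e)
    have "c \<otimes> d \<otimes> (x \<oplus> y) [^] (p ^ e) = d \<otimes> (c \<otimes> x [^] (p ^ e)) \<oplus> c \<otimes> (d \<otimes> y [^] (p ^ e))"
      using cd x(1) y(1) by (simp add: frobenius_add[OF p] r_distr m_ac)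
    also have "\<dots> \<in> K e"
      using elim cd K[of e] by (meson additive_subgroup.a_closed ideal.I_l_closed ideal.axioms(1))
    finally show ?case .
  qed
qed

lemma weak_closure_add:
  assumes p: "Factorial_Ring.prime p" "has_characteristic R p" and I: "ideal I R"
    and "x \<in> weak_closure R p s I" "y \<in> weak_closure R p s I"
  shows "x \<oplus> y \<in> weak_closure R p s I"
  using frobenius_closure_add[OF p, of "\<lambda>e. mixed_power R I s (p ^ e)" x _ y] mixed_power_ideal[OF I] assms(4,5)
  unfolding weak_closure_def by blast

lemma tight_closure_add:
  assumes p: "Factorial_Ring.prime p" "has_characteristic R p" and I: "ideal I R"
    and "x \<in> tight_closure R p I" "y \<in> tight_closure R p I"
  shows "x \<oplus> y \<in> tight_closure R p I"
  using frobenius_closure_add[OF p, of "\<lambda>e. frobenius_power R I (p ^ e)" x _ y] frobenius_power_ideal[OF I] assms(4,5)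
  unfolding tight_closure_def by blast

lemma rational_power_subset_weak_closure:
  assumes p: "Factorial_Ring.prime p" and I: "ideal I R" and s: "1 \<le> s"
  shows "rational_power R I s \<subseteq> weak_closure R p (real_of_rat s) I"
proof
  fix x assume x: "x \<in> rational_power R I s"
  then have xc: "x \<in> carrier R" by (simp add: rational_power_def)
  define f where "f n = nat \<lceil>real_of_rat s * real n\<rceil>" for n
  obtain D where D: "\<And>n. x [^] n \<in> ideal_power R I (f n - D)"
    using rational_power_bounded_deficiency[OF I x] unfolding f_def by blast
  have "n \<le> f n" for n
  proof -
    have "1 * real n \<le> real_of_rat s * real n" using s by (intro mult_right_mono) auto
    also have "\<dots> \<le> real_of_int \<lceil>real_of_rat s * real n\<rceil>" by simp
    finally show ?thesis unfolding f_def by linarith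
  qed
  from this[of "D + 1"] have "x [^] (D + 1) \<in> ideal_power R I 1"
    by (intro ideal_power_mem_antimono[OF I D]) simp
  then have k: "x [^] (D + 1) \<in> I" using ideal_power_1[OF I] by simp
  obtain c N where c: "c \<in> off_minimal_primes R"
    and N: "\<And>n. N \<le> n \<Longrightarrow> c \<otimes> x [^] n \<in> ideal_power R I (f n)"
    using absorb_bounded_deficiency[OF I xc D k] by blast
  have "\<forall>\<^sub>F e in sequentially. c \<otimes> x [^] (p ^ e) \<in> mixed_power R I (real_of_rat s) (p ^ e)"
    using eventually_ge_at_top[of N]
  proof eventually_elim
    case (elim e)
    have "e < p ^ e" using prime_gt_1_nat[OF p] by (intro power_gt_expt) auto
    then have "c \<otimes> x [^] (p ^ e) \<in> ideal_power R I (f (p ^ e))" using elim by (intro N) simp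
    then show ?case using ideal_power_subset_mixed_power[OF I] unfolding f_def by blast
  qed
  then show "x \<in> weak_closure R p (real_of_rat s) I"
    using c xc unfolding weak_closure_def by blast
qed

theorem tight_closure_rational_power_subset_weak_closure:
  assumes p: "Factorial_Ring.prime p" "has_characteristic R p" and I: "ideal I R" and s: "1 \<le> s"
  shows "tight_closure R p I <+>\<^bsub>R\<^esub> rational_power R I s \<subseteq> weak_closure R p (real_of_rat s) I"
  using weak_closure_add[OF p I] tight_closure_subset_weak_closure[OF I]
    rational_power_subset_weak_closure[OF p(1) I s]
  unfolding set_add_def' by blast

end

section \<open>Integrality from a finitely generated module\<close>

text \<open>With \<open>K\<close> constant this is the product of an ideal with the module spanned by \<open>u\<close>. The
coefficient ideal may depend on the index, because the lower-order parts of equations of integral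
dependence have this shape as well.\<close>

definition linear_combinations ::
  "('a, 'm) ring_scheme \<Rightarrow> 'i set \<Rightarrow> ('i \<Rightarrow> 'a set) \<Rightarrow> ('i \<Rightarrow> 'a) \<Rightarrow> 'a set" where
  "linear_combinations R F K u = {\<Oplus>\<^bsub>R\<^esub>i\<in>F. a i \<otimes>\<^bsub>R\<^esub> u i | a. \<forall>i\<in>F. a i \<in> K i}"

text \<open>The values \<open>\<Sum>\<^bsub>1\<le>i\<le>d\<^esub> a\<^sub>i y\<^bsup>d-i\<^esup>\<close> with \<open>a\<^sub>i \<in> J\<^sup>i\<close>; in \<open>monic_values\<close> the leading term \<open>y\<^sup>d\<close> is
added, so \<open>y\<close> is integral over \<open>J\<close> exactly if \<open>0\<close> is a monic value of positive degree.\<close>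

definition lower_terms :: "('a, 'm) ring_scheme \<Rightarrow> 'a set \<Rightarrow> 'a \<Rightarrow> nat \<Rightarrow> 'a set" where
  "lower_terms R J y d = linear_combinations R {1..d} (ideal_power R J) (\<lambda>i. y [^]\<^bsub>R\<^esub> (d - i))"

definition monic_values :: "('a, 'm) ring_scheme \<Rightarrow> 'a set \<Rightarrow> 'a \<Rightarrow> nat \<Rightarrow> 'a set" where
  "monic_values R J y d = {y [^]\<^bsub>R\<^esub> d \<oplus>\<^bsub>R\<^esub> l | l. l \<in> lower_terms R J y d}"

context cring
begin

lemma linear_combinations_ideal:
  assumes F: "finite F" and K: "\<And>i. i \<in> F \<Longrightarrow> ideal (K i) R"
    and u: "\<And>i. i \<in> F \<Longrightarrow> u i \<in> carrier R"
  shows "ideal (linear_combinations R F K u) R"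
proof -
  have Kc: "a \<in> carrier R" if "i \<in> F" "a \<in> K i" for i a using ideal.Icarr[OF K] that by blast
  have l: "x \<otimes> z \<in> linear_combinations R F K u"
    if x: "x \<in> carrier R" and "z \<in> linear_combinations R F K u" for x z
  proof -
    obtain a where a: "\<And>i. i \<in> F \<Longrightarrow> a i \<in> K i" "z = (\<Oplus>i\<in>F. a i \<otimes> u i)"
      using \<open>z \<in> _\<close> unfolding linear_combinations_def by blast
    have "x \<otimes> z = (\<Oplus>i\<in>F. x \<otimes> (a i \<otimes> u i))"
      unfolding a(2) using F x a(1) u Kc by (intro finsum_rdistr) auto
    also have "\<dots> = (\<Oplus>i\<in>F. (x \<otimes> a i) \<otimes> u i)"
      using x a(1) u Kc by (intro finsum_cong') (auto simp: m_assoc)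
    finally show ?thesis
      using ideal.I_l_closed[OF K] a(1) x unfolding linear_combinations_def
      by (intro CollectI exI[of _ "\<lambda>i. x \<otimes> a i"]) auto
  qed
  have c: "z \<in> carrier R" if "z \<in> linear_combinations R F K u" for z
    using that u Kc unfolding linear_combinations_def by (auto intro!: finsum_closed)
  show ?thesis
  proof (rule idealI[OF ring_axioms])
    show "subgroup (linear_combinations R F K u) (add_monoid R)"
    proof (rule add.subgroupI)
      show "linear_combinations R F K u \<subseteq> carrier R" using c by blast
      have "(\<Oplus>i\<in>F. \<zero> \<otimes> u i) \<in> linear_combinations R F K u"
        unfolding linear_combinations_def
        using additive_subgroup.zero_closed[OF ideal.axioms(1)[OF K]]
        by (intro CollectI exI[of _ "\<lambda>_. \<zero>"]) auto
      then show "linear_combinations R F K u \<noteq> {}" by blast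
      show "\<ominus> z \<in> linear_combinations R F K u" if "z \<in> linear_combinations R F K u" for z
        using l[OF _ that, of "\<ominus> \<one>"] c[OF that] by (simp add: l_minus)
      fix z w assume zw: "z \<in> linear_combinations R F K u" "w \<in> linear_combinations R F K u"
      obtain a where a: "\<And>i. i \<in> F \<Longrightarrow> a i \<in> K i" "z = (\<Oplus>i\<in>F. a i \<otimes> u i)"
        using zw(1) unfolding linear_combinations_def by blast
      obtain b where b: "\<And>i. i \<in> F \<Longrightarrow> b i \<in> K i" "w = (\<Oplus>i\<in>F. b i \<otimes> u i)"
        using zw(2) unfolding linear_combinations_def by blast
      have "z \<oplus> w = (\<Oplus>i\<in>F. a i \<otimes> u i \<oplus> b i \<otimes> u i)"
        unfolding a(2) b(2) using a(1) b(1) u Kc by (subst finsum_addf) auto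
      also have "\<dots> = (\<Oplus>i\<in>F. (a i \<oplus> b i) \<otimes> u i)"
        using a(1) b(1) u Kc by (intro finsum_cong') (auto simp: l_distr)
      finally show "z \<oplus> w \<in> linear_combinations R F K u"
        using additive_subgroup.a_closed[OF ideal.axioms(1)[OF K]] a(1) b(1)
        unfolding linear_combinations_def
        by (intro CollectI exI[of _ "\<lambda>i. a i \<oplus> b i"]) auto
    qed
    show "x \<otimes> z \<in> linear_combinations R F K u"
      if "z \<in> linear_combinations R F K u" "x \<in> carrier R" for z x
      using l that by blast
    then show "z \<otimes> x \<in> linear_combinations R F K u"
      if "z \<in> linear_combinations R F K u" "x \<in> carrier R" for z x
      using that c by (metis m_comm)
  qed
qed

lemma linear_combinationsI:
  assumes F: "finite F" and K: "\<And>i. i \<in> F \<Longrightarrow> ideal (K i) R"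
    and u: "\<And>i. i \<in> F \<Longrightarrow> u i \<in> carrier R" and i: "i \<in> F" "a \<in> K i"
  shows "a \<otimes> u i \<in> linear_combinations R F K u"
proof -
  let ?a = "\<lambda>j. if j = i then a else \<zero>"
  have ac: "a \<in> carrier R" using ideal.Icarr[OF K] i by blast
  have "(\<Oplus>j\<in>F. ?a j \<otimes> u j) = (\<Oplus>j\<in>F. if i = j then a \<otimes> u j else \<zero>)"
    using u ac by (intro finsum_cong') auto
  also have "\<dots> = a \<otimes> u i" using F i u ac by (intro finsum_singleton) auto
  finally show ?thesis
    using i additive_subgroup.zero_closed[OF ideal.axioms(1)[OF K]]
    unfolding linear_combinations_def by (intro CollectI exI[of _ ?a]) auto
qed

lemma linear_combinations_mult_mem:
  assumes F: "finite F" and K: "\<And>i a. i \<in> F \<Longrightarrow> a \<in> K i \<Longrightarrow> a \<in> carrier R"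
    and u: "\<And>i. i \<in> F \<Longrightarrow> u i \<in> carrier R"
    and z: "z \<in> linear_combinations R F K u" and w: "w \<in> carrier R" and L: "ideal L R"
    and gen: "\<And>i a. i \<in> F \<Longrightarrow> a \<in> K i \<Longrightarrow> a \<otimes> u i \<otimes> w \<in> L"
  shows "z \<otimes> w \<in> L"
proof -
  obtain a where a: "\<And>i. i \<in> F \<Longrightarrow> a i \<in> K i" "z = (\<Oplus>i\<in>F. a i \<otimes> u i)"
    using z unfolding linear_combinations_def by blast
  have "z \<otimes> w = (\<Oplus>i\<in>F. a i \<otimes> u i \<otimes> w)"
    unfolding a(2) using F K u a(1) w by (intro finsum_ldistr) auto
  then show ?thesis using gen a(1) by (auto intro!: ideal_finsum_closed[OF L])
qed

context
  fixes J y
  assumes J: "ideal J R" and y [simp]: "y \<in> carrier R"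
begin

private abbreviation "L \<equiv> lower_terms R J y"
private abbreviation "N \<equiv> monic_values R J y"

lemma lower_ideal: "ideal (L d) R"
  unfolding lower_terms_def by (intro linear_combinations_ideal ideal_power_ideal J) auto

lemma lower_carrier: "l \<in> L d \<Longrightarrow> l \<in> carrier R"
  using ideal.Icarr[OF lower_ideal] .

lemma lowerI: "1 \<le> i \<Longrightarrow> i \<le> d \<Longrightarrow> a \<in> ideal_power R J i \<Longrightarrow> a \<otimes> y [^] (d - i) \<in> L d"
  unfolding lower_terms_def
  by (intro linear_combinationsI[where u = "\<lambda>i. y [^] (d - i)"] ideal_power_ideal J) auto

lemma lower_mult_mem:
  assumes "z \<in> L d" "w \<in> carrier R" "ideal M R"
    and "\<And>i a. 1 \<le> i \<Longrightarrow> i \<le> d \<Longrightarrow> a \<in> ideal_power R J i \<Longrightarrow> a \<otimes> y [^] (d - i) \<otimes> w \<in> M"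
  shows "z \<otimes> w \<in> M"
  using assms(1) unfolding lower_terms_def
  by (rule linear_combinations_mult_mem[rotated 3])
    (use assms(2-4) ideal_power_carrier[OF J] in auto)

lemma lower_mult_power: "z \<in> L d \<Longrightarrow> z \<otimes> y [^] k \<in> L (d + k)"
proof (erule lower_mult_mem)
  fix i a assume i: "1 \<le> i" "i \<le> d" "a \<in> ideal_power R J i"
  have "a \<otimes> y [^] (d - i) \<otimes> y [^] k = a \<otimes> y [^] (d + k - i)"
    using i ideal_power_carrier[OF J i(3)] by (simp add: m_assoc nat_pow_mult)
  then show "a \<otimes> y [^] (d - i) \<otimes> y [^] k \<in> L (d + k)"
    using lowerI[of i "d + k" a] i by auto
qed (auto simp: lower_ideal)

lemma lower_mult_lower:
  assumes z: "z \<in> L d" and w: "w \<in> L k"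
  shows "z \<otimes> w \<in> L (d + k)"
  using z lower_carrier[OF w] lower_ideal
proof (rule lower_mult_mem)
  fix i a assume i: "1 \<le> i" "i \<le> d" "a \<in> ideal_power R J i"
  have a: "a \<in> carrier R" using ideal_power_carrier[OF J i(3)] .
  have "w \<otimes> (a \<otimes> y [^] (d - i)) \<in> L (d + k)"
    using w _ lower_ideal
  proof (rule lower_mult_mem)
    show "a \<otimes> y [^] (d - i) \<in> carrier R" using a by simp
    fix j b assume j: "1 \<le> j" "j \<le> k" "b \<in> ideal_power R J j"
    have b: "b \<in> carrier R" using ideal_power_carrier[OF J j(3)] .
    have "b \<otimes> y [^] (k - j) \<otimes> (a \<otimes> y [^] (d - i)) = (a \<otimes> b) \<otimes> (y [^] (d - i) \<otimes> y [^] (k - j))"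
      using a b by (simp add: m_ac)
    also have "y [^] (d - i) \<otimes> y [^] (k - j) = y [^] (d + k - (i + j))"
      using i j by (simp add: nat_pow_mult)
    also have "(a \<otimes> b) \<otimes> \<dots> \<in> L (d + k)"
      using i j by (intro lowerI ideal_power_mult_mem J) auto
    finally show "b \<otimes> y [^] (k - j) \<otimes> (a \<otimes> y [^] (d - i)) \<in> L (d + k)" .
  qed
  then show "a \<otimes> y [^] (d - i) \<otimes> w \<in> L (d + k)"
    using a lower_carrier[OF w] by (simp add: m_comm)
qed

lemma monic_carrier: "z \<in> N d \<Longrightarrow> z \<in> carrier R"
  using lower_carrier unfolding monic_values_def by auto

lemma monic_mult_lower: "z \<in> N d \<Longrightarrow> w \<in> L k \<Longrightarrow> z \<otimes> w \<in> L (d + k)"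
proof -
  assume z: "z \<in> N d" and w: "w \<in> L k"
  obtain l where l: "l \<in> L d" "z = y [^] d \<oplus> l" using z unfolding monic_values_def by blast
  have "z \<otimes> w = w \<otimes> y [^] d \<oplus> l \<otimes> w"
    using l lower_carrier[OF w] lower_carrier[OF l(1)] by (simp add: l_distr m_comm[of w])
  moreover have "w \<otimes> y [^] d \<in> L (d + k)" using lower_mult_power[OF w, of d] by (simp add: add.commute)
  ultimately show ?thesis
    using lower_mult_lower[OF l(1) w] lower_ideal
    by (simp add: additive_subgroup.a_closed ideal.axioms(1))
qed

lemma monic_plus_lower: "z \<in> N d \<Longrightarrow> l \<in> L d \<Longrightarrow> z \<oplus> l \<in> N d"
proof -
  assume z: "z \<in> N d" and l: "l \<in> L d"
  obtain l' where l': "l' \<in> L d" "z = y [^] d \<oplus> l'" using z unfolding monic_values_def by blast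
  have "z \<oplus> l = y [^] d \<oplus> (l' \<oplus> l)"
    using l'(2) lower_carrier[OF l] lower_carrier[OF l'(1)] by (simp add: a_assoc)
  moreover have "l' \<oplus> l \<in> L d"
    using l l'(1) lower_ideal by (simp add: additive_subgroup.a_closed ideal.axioms(1))
  ultimately show ?thesis unfolding monic_values_def by blast
qed

lemma monic_mult: "z \<in> N d \<Longrightarrow> w \<in> N k \<Longrightarrow> z \<otimes> w \<in> N (d + k)"
proof -
  assume z: "z \<in> N d" and w: "w \<in> N k"
  obtain l where l: "l \<in> L d" "z = y [^] d \<oplus> l" using z unfolding monic_values_def by blast
  obtain m where m: "m \<in> L k" "w = y [^] k \<oplus> m" using w unfolding monic_values_def by blast
  have "z \<otimes> w = y [^] (d + k) \<oplus> (l \<otimes> y [^] k \<oplus> z \<otimes> m)"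
    using l(2) m(2) lower_carrier[OF l(1)] lower_carrier[OF m(1)]
    by (simp add: l_distr r_distr a_ac m_ac nat_pow_mult[symmetric])
  moreover have "l \<otimes> y [^] k \<oplus> z \<otimes> m \<in> L (d + k)"
    using lower_mult_power[OF l(1)] monic_mult_lower[OF z m(1)] lower_ideal
    by (simp add: additive_subgroup.a_closed ideal.axioms(1))
  ultimately show ?thesis unfolding monic_values_def by blast
qed

lemma lower_a_inv: "l \<in> L d \<Longrightarrow> \<ominus> l \<in> L d"
  using lower_ideal by (simp add: additive_subgroup.a_inv_closed ideal.axioms(1))

lemma one_monic: "\<one> \<in> N 0"
proof -
  have "\<zero> \<in> L 0" using lower_ideal by (simp add: additive_subgroup.zero_closed ideal.axioms(1))
  then have "y [^] (0::nat) \<oplus> \<zero> \<in> N 0" unfolding monic_values_def by blast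
  then show ?thesis by simp
qed

text \<open>A determinant trick by elimination: the matrix \<open>B\<close> has monic values on the diagonal
and lower-order ones elsewhere. Using row \<open>l\<close> as pivot row without division keeps this shape and
doubles the degree, so the determinant need not be mentioned.\<close>

lemma monic_annihilator:
  assumes "finite F"
    and "\<And>i. i \<in> F \<Longrightarrow> u i \<in> carrier R"
    and "\<And>i. i \<in> F \<Longrightarrow> B i i \<in> N d"
    and "\<And>i j. i \<in> F \<Longrightarrow> j \<in> F \<Longrightarrow> i \<noteq> j \<Longrightarrow> B i j \<in> L d"
    and "\<And>i. i \<in> F \<Longrightarrow> (\<Oplus>j\<in>F. B i j \<otimes> u j) = \<zero>"
  shows "\<exists>n. \<exists>\<Delta>\<in>N n. \<forall>j\<in>F. \<Delta> \<otimes> u j = \<zero>"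
  using assms
proof (induction F arbitrary: B d rule: finite_induct)
  case empty
  then show ?case using one_monic by blast
next
  case (insert l F)
  note u = insert.prems(1) and diag = insert.prems(2) and off = insert.prems(3)
    and rel = insert.prems(4)
  have Bc: "B i j \<in> carrier R" if "i \<in> insert l F" "j \<in> insert l F" for i j
    using that diag[OF that(1)] off[OF that] monic_carrier lower_carrier by (cases "i = j") auto
  define s where "s i = (\<Oplus>j\<in>F. B i j \<otimes> u j)" for i
  have sc: "s i \<in> carrier R" if "i \<in> insert l F" for i
    unfolding s_def using Bc[OF that] u by (intro finsum_closed) auto
  have split: "B i l \<otimes> u l \<oplus> s i = \<zero>" if "i \<in> insert l F" for i
    using rel[OF that] insert.hyps Bc[OF that] u unfolding s_def by (subst (asm) finsum_insert) auto
  have uc: "u l \<in> carrier R" using u by simp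
  have s: "s i = \<ominus> (B i l \<otimes> u l)" if "i \<in> insert l F" for i
    using split[OF that] sc[OF that] Bc[OF that, of l] uc
    by (metis add.inv_equality add.m_comm insertI1 m_closed a_inv_def)
  \<comment> \<open>The pivot step: row \<open>i\<close> times the pivot minus a multiple of row \<open>l\<close>.\<close>
  define B' where "B' i j = B l l \<otimes> B i j \<oplus> \<ominus> (B i l \<otimes> B l j)" for i j
  have "\<exists>n. \<exists>\<Delta>\<in>N n. \<forall>j\<in>F. \<Delta> \<otimes> u j = \<zero>"
  proof (rule insert.IH[of B' "d + d"])
    show "u i \<in> carrier R" if "i \<in> F" for i using u that by simp
    show "B' i i \<in> N (d + d)" if "i \<in> F" for i
      unfolding B'_def using that insert.hyps(2)
      by (intro monic_plus_lower monic_mult lower_a_inv lower_mult_lower diag off) auto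
    show "B' i j \<in> L (d + d)" if "i \<in> F" "j \<in> F" "i \<noteq> j" for i j
      unfolding B'_def using that insert.hyps(2)
      by (intro additive_subgroup.a_closed[OF ideal.axioms(1)[OF lower_ideal]] monic_mult_lower
          lower_a_inv lower_mult_lower diag off) auto
    fix i assume i: "i \<in> F"
    have "(\<Oplus>j\<in>F. B' i j \<otimes> u j)
      = (\<Oplus>j\<in>F. B l l \<otimes> (B i j \<otimes> u j) \<oplus> (\<ominus> B i l) \<otimes> (B l j \<otimes> u j))"
      using i Bc u unfolding B'_def by (intro finsum_cong') (auto simp: l_distr l_minus m_assoc)
    also have "\<dots> = (\<Oplus>j\<in>F. B l l \<otimes> (B i j \<otimes> u j)) \<oplus> (\<Oplus>j\<in>F. (\<ominus> B i l) \<otimes> (B l j \<otimes> u j))"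
      using i Bc u by (intro finsum_addf) auto
    also have "\<dots> = B l l \<otimes> s i \<oplus> (\<ominus> B i l) \<otimes> s l"
      using i Bc u insert.hyps(1) unfolding s_def by (subst (1 2) finsum_rdistr[symmetric]) auto
    also have "\<dots> = \<zero>"
      using i Bc[of i l] Bc[of l l] uc
      by (simp add: s l_minus r_minus m_ac l_neg)
    finally show "(\<Oplus>j\<in>F. B' i j \<otimes> u j) = \<zero>" .
  qed
  then obtain n \<Delta> where D: "\<Delta> \<in> N n" "\<And>j. j \<in> F \<Longrightarrow> \<Delta> \<otimes> u j = \<zero>" by blast
  have Dc: "\<Delta> \<in> carrier R" using monic_carrier[OF D(1)] .
  have "(\<Delta> \<otimes> B l l) \<otimes> u j = \<zero>" if "j \<in> insert l F" for j
  proof (cases "j = l")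
    case True
    have "\<Delta> \<otimes> s l = (\<Oplus>j\<in>F. \<Delta> \<otimes> (B l j \<otimes> u j))"
      unfolding s_def using Bc u Dc insert.hyps(1) by (intro finsum_rdistr) auto
    also have "\<dots> = (\<Oplus>j\<in>F. \<zero>)"
    proof (intro finsum_cong')
      fix j assume j: "j \<in> F"
      have "\<Delta> \<otimes> (B l j \<otimes> u j) = B l j \<otimes> (\<Delta> \<otimes> u j)"
        using Bc[of l j] u[of j] Dc j by (simp add: m_lcomm)
      then show "\<Delta> \<otimes> (B l j \<otimes> u j) = \<zero>" using D(2)[OF j] Bc[of l j] j by simp
    qed auto
    finally have "\<Delta> \<otimes> s l = \<zero>" by simp
    then have "\<ominus> (\<Delta> \<otimes> (B l l \<otimes> u l)) = \<zero>" using s[of l] Dc Bc[of l l] uc by (simp add: r_minus)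
    then have "\<Delta> \<otimes> (B l l \<otimes> u l) = \<zero>" using Dc Bc[of l l] uc by (metis m_closed minus_minus minus_zero insertI1)
    then show ?thesis using True Dc Bc[of l l] uc by (simp add: m_assoc)
  next
    case False
    then have j: "j \<in> F" using that by simp
    have "(\<Delta> \<otimes> B l l) \<otimes> u j = B l l \<otimes> (\<Delta> \<otimes> u j)"
      using Bc[of l l] u[of j] Dc j by (simp add: m_ac)
    then show ?thesis using D(2)[OF j] Bc[of l l] by simp
  qed
  moreover have "\<Delta> \<otimes> B l l \<in> N (n + d)" using monic_mult[OF D(1) diag] by simp
  ultimately show ?case by blast
qed

end

end

text \<open>The usual criterion \<open>y M \<subseteq> J M\<close> for a nonzero finitely generated module \<open>M\<close>, whose generators
are the \<open>u i\<close>: the matrix \<open>y - (a\<^sub>i\<^sub>j)\<close> annihilates them.\<close>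

lemma (in domain) integral_if_faithful_module:
  assumes J: "ideal J R" and y: "y \<in> carrier R" and F: "finite F"
    and u: "\<And>i. i \<in> F \<Longrightarrow> u i \<in> carrier R" and nz: "\<exists>i\<in>F. u i \<noteq> \<zero>"
    and mult: "\<And>i. i \<in> F \<Longrightarrow> y \<otimes> u i \<in> linear_combinations R F (\<lambda>_. J) u"
  shows "y \<in> integral_closure R J"
proof -
  have "\<exists>a. (\<forall>j\<in>F. a j \<in> J) \<and> y \<otimes> u i = (\<Oplus>j\<in>F. a j \<otimes> u j)" if "i \<in> F" for i
    using mult[OF that] unfolding linear_combinations_def by blast
  then obtain a where a: "\<And>i j. i \<in> F \<Longrightarrow> j \<in> F \<Longrightarrow> a i j \<in> J"
    "\<And>i. i \<in> F \<Longrightarrow> y \<otimes> u i = (\<Oplus>j\<in>F. a i j \<otimes> u j)" by metis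
  have ac: "a i j \<in> carrier R" if "i \<in> F" "j \<in> F" for i j using ideal.Icarr[OF J a(1)[OF that]] .
  have low: "\<ominus> a i j \<in> lower_terms R J y 1" if "i \<in> F" "j \<in> F" for i j
    using lowerI[OF J y, of 1 1 "a i j"] lower_a_inv[OF J y, of "a i j" 1] a(1) ac that
    by (simp add: ideal_power_1[OF J, simplified])
  define B where "B i j = (if i = j then y \<oplus> \<ominus> a i j else \<ominus> a i j)" for i j
  have "\<exists>n. \<exists>\<Delta>\<in>monic_values R J y n. \<forall>j\<in>F. \<Delta> \<otimes> u j = \<zero>"
  proof (rule monic_annihilator[OF J y F u, where B = B and d = 1])
    show "B i i \<in> monic_values R J y 1" if "i \<in> F" for i
      using low[OF that that] y unfolding B_def monic_values_def by (auto intro: exI[of _ "\<ominus> a i i"])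
    show "B i j \<in> lower_terms R J y 1" if "i \<in> F" "j \<in> F" "i \<noteq> j" for i j
      using low[OF that(1,2)] that(3) unfolding B_def by simp
    fix i assume i: "i \<in> F"
    have "(\<Oplus>j\<in>F. B i j \<otimes> u j) = (\<Oplus>j\<in>F. (if i = j then y \<otimes> u j else \<zero>) \<oplus> (\<ominus> \<one>) \<otimes> (a i j \<otimes> u j))"
      using i ac u y unfolding B_def by (intro finsum_cong') (auto simp: l_distr l_minus)
    also have "\<dots> = (\<Oplus>j\<in>F. if i = j then y \<otimes> u j else \<zero>) \<oplus> (\<Oplus>j\<in>F. (\<ominus> \<one>) \<otimes> (a i j \<otimes> u j))"
      using i ac u y by (intro finsum_addf) auto
    also have "(\<Oplus>j\<in>F. if i = j then y \<otimes> u j else \<zero>) = y \<otimes> u i"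
      using i F u y by (intro finsum_singleton) auto
    also have "(\<Oplus>j\<in>F. (\<ominus> \<one>) \<otimes> (a i j \<otimes> u j)) = \<ominus> \<one> \<otimes> (\<Oplus>j\<in>F. a i j \<otimes> u j)"
      using i F u ac by (intro finsum_rdistr[symmetric]) auto
    also have "\<dots> = \<ominus> \<one> \<otimes> (y \<otimes> u i)" using a(2)[OF i] by simp
    finally show "(\<Oplus>j\<in>F. B i j \<otimes> u j) = \<zero>"
      using u[OF i] y by (simp add: l_minus r_neg)
  qed
  then obtain n \<Delta> where D: "\<Delta> \<in> monic_values R J y n" "\<And>j. j \<in> F \<Longrightarrow> \<Delta> \<otimes> u j = \<zero>" by blast
  have "\<Delta> = \<zero>" using D nz u monic_carrier[OF J y D(1)] integral by blast
  with D(1) obtain a where a: "\<forall>i\<in>{1..n}. a i \<in> ideal_power R J i"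
    "y [^] n \<oplus> (\<Oplus>i\<in>{1..n}. a i \<otimes> y [^] (n - i)) = \<zero>"
    unfolding monic_values_def lower_terms_def linear_combinations_def by auto
  have "n \<noteq> 0"
  proof
    assume "n = 0"
    then show False using a(2) by simp
  qed
  then show ?thesis using a y unfolding integral_closure_def by blast
qed

section \<open>Multiples in an ordered monoid and Dickson's lemma\<close>

definition nat_multiple :: "nat \<Rightarrow> 'g::comm_monoid_add \<Rightarrow> 'g" where
  "nat_multiple n v = sum_mset (replicate_mset n v)"

lemma nat_multiple_0 [simp]: "nat_multiple 0 v = 0"
  and nat_multiple_Suc: "nat_multiple (Suc n) v = v + nat_multiple n v"
  by (simp_all add: nat_multiple_def)

lemma nat_multiple_plus: "nat_multiple (m + n) v = nat_multiple m v + nat_multiple n v"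
  by (induction m) (simp_all add: nat_multiple_Suc add_ac)

lemma nat_multiple_add: "nat_multiple n (v + w) = nat_multiple n v + nat_multiple n w"
  by (induction n) (simp_all add: nat_multiple_Suc add_ac)

lemma nat_multiple_mult: "nat_multiple (m * n) v = nat_multiple m (nat_multiple n v)"
  by (induction m) (simp_all add: nat_multiple_Suc nat_multiple_plus)

lemma nat_multiple_sum_mset: "nat_multiple n (sum_mset G) = sum_mset (repeat_mset n G)"
  by (induction n) (simp_all add: nat_multiple_Suc)

lemma nat_multiple_strict_mono:
  fixes v w :: "'g::{ordered_cancel_comm_monoid_add, linorder}"
  assumes "v < w" "0 < n"
  shows "nat_multiple n v < nat_multiple n w"
  using assms(2)
proof (induction n)
  case (Suc n)
  then show ?case using assms(1)
    by (cases n) (auto simp: nat_multiple_Suc intro!: add_strict_mono)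
qed simp

lemma nat_multiple_inj:
  fixes v w :: "'g::{ordered_cancel_comm_monoid_add, linorder}"
  assumes "nat_multiple n v = nat_multiple n w" "0 < n"
  shows "v = w"
  using nat_multiple_strict_mono[of v w n] nat_multiple_strict_mono[of w v n] assms
  by (cases v w rule: linorder_cases) auto

text \<open>Two meetings would make a positive multiple of \<open>v\<close> equal to the same multiple of \<open>v'\<close>, which the
order excludes. Hence for large \<open>n\<close> no cancellation can occur between the terms \<open>u + n v\<close>.\<close>

lemma translates_meet_once:
  fixes u u' v v' :: "'g::{ordered_cancel_comm_monoid_add, linorder}"
  assumes "v \<noteq> v'"
    and "u + nat_multiple n v = u' + nat_multiple n v'"
    and "u + nat_multiple m v = u' + nat_multiple m v'"
  shows "m = n"
proof -
  have False if "n < m" and n: "u + nat_multiple n v = u' + nat_multiple n v'"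
    and m: "u + nat_multiple m v = u' + nat_multiple m v'" for n m
  proof -
    have "(u + nat_multiple n v) + nat_multiple (m - n) v
        = (u' + nat_multiple n v') + nat_multiple (m - n) v'"
      using m nat_multiple_plus[of n "m - n" v] nat_multiple_plus[of n "m - n" v'] \<open>n < m\<close>
      by (simp add: add.assoc)
    then have "nat_multiple (m - n) v = nat_multiple (m - n) v'" using n by simp
    then show False using nat_multiple_inj assms(1) \<open>n < m\<close> by (metis zero_less_diff)
  qed
  then show ?thesis using assms(2,3) by (metis linorder_cases)
qed

lemma nat_seq_incseq_subseq:
  fixes f :: "nat \<Rightarrow> nat"
  shows "\<exists>r. strict_mono (r :: nat \<Rightarrow> nat) \<and> incseq (\<lambda>n. f (r n))"
proof -
  obtain r :: "nat \<Rightarrow> nat" where r: "strict_mono r" "monoseq (\<lambda>n. f (r n))"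
    using seq_monosub by blast
  show ?thesis
  proof (cases "incseq (\<lambda>n. f (r n))")
    case True
    then show ?thesis using r(1) by blast
  next
    case False
    then have dec: "decseq (\<lambda>n. f (r n))" using r(2) by (simp add: monoseq_iff)
    define N where "N = (ARG_MIN (\<lambda>n. f (r n)) n. True)"
    have "f (r (N + n)) = f (r N)" for n
      using arg_min_nat_le[of "\<lambda>_. True" "N + n" "\<lambda>n. f (r n)"] decseqD[OF dec, of N "N + n"]
      unfolding N_def by auto
    then have "incseq (\<lambda>n. f (r (N + n)))" by (simp add: incseq_def)
    moreover have "strict_mono (\<lambda>n. r (N + n))" using r(1) by (simp add: strict_mono_def)
    ultimately show ?thesis by blast
  qed
qed

lemma dickson_multiset:
  fixes W :: "nat \<Rightarrow> 'b multiset"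
  assumes A: "finite A" and W: "\<And>n. set_mset (W n) \<subseteq> A"
  shows "\<exists>r. strict_mono (r :: nat \<Rightarrow> nat) \<and> (\<forall>i j. i \<le> j \<longrightarrow> W (r i) \<subseteq># W (r j))"
proof -
  have "\<exists>r. strict_mono (r :: nat \<Rightarrow> nat) \<and> (\<forall>a\<in>A. incseq (\<lambda>n. count (W (r n)) a))"
    using A
  proof (induction A rule: finite_induct)
    case empty
    then show ?case using strict_mono_id by blast
  next
    case (insert a A)
    then obtain r :: "nat \<Rightarrow> nat" where
      r: "strict_mono r" "\<forall>a\<in>A. incseq (\<lambda>n. count (W (r n)) a)" by blast
    obtain t :: "nat \<Rightarrow> nat" where t: "strict_mono t" "incseq (\<lambda>n. count (W (r (t n))) a)"
      using nat_seq_incseq_subseq[of "\<lambda>n. count (W (r n)) a"] by blast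
    have "strict_mono (\<lambda>n. r (t n))" using r(1) t(1) by (simp add: strict_mono_def)
    moreover have "incseq (\<lambda>n. count (W (r (t n))) b)" if "b \<in> insert a A" for b
      using that t r(2) strict_mono_mono[OF t(1)] by (auto simp: incseq_def mono_def)
    ultimately show ?case by blast
  qed
  then obtain r :: "nat \<Rightarrow> nat" where
    r: "strict_mono r" "\<forall>a\<in>A. incseq (\<lambda>n. count (W (r n)) a)" by blast
  have "W (r i) \<subseteq># W (r j)" if "i \<le> j" for i j
  proof (rule mset_subset_eqI)
    fix a
    show "count (W (r i)) a \<le> count (W (r j)) a"
    proof (cases "a \<in> A")
      case True
      then show ?thesis using r(2) that by (auto simp: incseq_def)
    next
      case False
      then have "a \<notin># W (r i)" using W by blast
      then show ?thesis by (simp add: not_in_iff)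
    qed
  qed
  with r(1) show ?thesis by blast
qed

text \<open>The heart of the argument on exponents. Infinitely many multiples of \<open>v\<close>, translated by one fixed
\<open>u\<close>, are sums of generators; by Dickson's lemma two of these representations are comparable, and
their difference is a representation of a multiple of \<open>v\<close> itself. The congruence modulo \<open>b\<close>, obtained
by the pigeonhole principle, later makes the rounding of \<open>a q / b\<close> disappear.\<close>

lemma bounded_translate_dickson:
  fixes u v :: "'g::{comm_monoid_add, cancel_ab_semigroup_add}" and q :: "nat \<Rightarrow> nat"
  assumes M: "finite M" and A: "finite A" and q: "strict_mono q" and b: "0 < b"
    and G: "\<And>n. set_mset (G n) \<subseteq> M" and W: "\<And>n. set_mset (W n) \<subseteq> A"
    and eq: "\<And>n. u + nat_multiple (q n) v = sum_mset (G n) + sum_mset (W n)"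
  shows "\<exists>i j Y. i < j \<and> q i mod b = q j mod b \<and> G i \<subseteq># G j \<and> set_mset Y \<subseteq> A
    \<and> nat_multiple (q j - q i) v = sum_mset (G j - G i) + sum_mset Y"
proof -
  obtain r :: "nat \<Rightarrow> nat" where r: "strict_mono r" "\<And>i j. i \<le> j \<Longrightarrow> G (r i) \<subseteq># G (r j)"
    using dickson_multiset[OF M, of G] G by blast
  obtain t :: "nat \<Rightarrow> nat" where t: "strict_mono t" "\<And>i j. i \<le> j \<Longrightarrow> W (r (t i)) \<subseteq># W (r (t j))"
    using dickson_multiset[OF A, of "\<lambda>n. W (r n)"] W by blast
  have "\<not> inj_on (\<lambda>n. q (r (t n)) mod b) {..b}"
  proof (rule pigeonhole)
    have "card ((\<lambda>n. q (r (t n)) mod b) ` {..b}) \<le> card {..<b}"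
      using b by (intro card_mono) auto
    then show "card ((\<lambda>n. q (r (t n)) mod b) ` {..b}) < card {..b}" by simp
  qed
  then obtain m n where mn: "m < n" "q (r (t m)) mod b = q (r (t n)) mod b"
    unfolding inj_on_def by (metis linorder_neqE_nat)
  define i where "i = r (t m)"
  define j where "j = r (t n)"
  have ij: "i < j" "q i < q j"
    using mn(1) r(1) t(1) q by (auto simp: i_def j_def strict_mono_def)
  have sub: "G i \<subseteq># G j" "W i \<subseteq># W j"
    using r(2)[of "t m" "t n"] t(2)[of m n] mn(1) strict_mono_mono[OF t(1)]
    by (auto simp: i_def j_def mono_def)
  have "(u + nat_multiple (q i) v) + nat_multiple (q j - q i) v = u + nat_multiple (q j) v"
    using ij(2) nat_multiple_plus[of "q i" "q j - q i" v] by (simp add: add.assoc)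
  also have "\<dots> = sum_mset (G i + (G j - G i)) + sum_mset (W i + (W j - W i))"
    using sub by (simp add: eq subset_mset.add_diff_inverse)
  also have "\<dots> = (u + nat_multiple (q i) v) + (sum_mset (G j - G i) + sum_mset (W j - W i))"
    unfolding eq by (simp add: add_ac)
  finally have "nat_multiple (q j - q i) v = sum_mset (G j - G i) + sum_mset (W j - W i)"
    by simp
  moreover have "set_mset (W j - W i) \<subseteq> A" using W in_diffD by fast
  ultimately show ?thesis using ij(1) mn(2) sub(1) by (auto simp: i_def j_def)
qed

section \<open>Frobenius powers in a semigroup ring\<close>

text \<open>In characteristic \<open>p\<close> this is the power \<open>f\<^sup>n\<close> when \<open>n\<close> is a power of \<open>p\<close>.\<close>

definition spread :: "nat \<Rightarrow> ('g::comm_monoid_add \<Rightarrow>\<^sub>0 'k::field) \<Rightarrow> 'g \<Rightarrow>\<^sub>0 'k" where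
  "spread n f = (\<Sum>v\<in>Poly_Mapping.keys f. Poly_Mapping.single (nat_multiple n v) (Poly_Mapping.lookup f v ^ n))"

lemma sum_single_keys:
  "(\<Sum>v\<in>Poly_Mapping.keys f. Poly_Mapping.single v (Poly_Mapping.lookup f v)) = f"
  by (rule poly_mapping_eqI)
    (auto simp: lookup_sum lookup_single when_def in_keys_iff)

lemma eventually_keys_spread_mult:
  fixes g f :: "'g::{ordered_cancel_comm_monoid_add, linorder} \<Rightarrow>\<^sub>0 'k::field"
  shows "\<forall>\<^sub>F n in sequentially. \<forall>u\<in>Poly_Mapping.keys g. \<forall>v\<in>Poly_Mapping.keys f.
    u + nat_multiple n v \<in> Poly_Mapping.keys (g * spread n f)"
proof -
  let ?U = "Poly_Mapping.keys g" and ?V = "Poly_Mapping.keys f"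
  have "\<forall>\<^sub>F n in sequentially. u + nat_multiple n v = u' + nat_multiple n v' \<longrightarrow> v = v'" for u u' v v' :: 'g
  proof (cases "v = v'")
    case False
    show ?thesis
    proof (cases "\<exists>m. u + nat_multiple m v = u' + nat_multiple m v'")
      case True
      then obtain m where "u + nat_multiple m v = u' + nat_multiple m v'" by blast
      then have "u + nat_multiple n v \<noteq> u' + nat_multiple n v'" if "m < n" for n
        using translates_meet_once[OF False, of u m u' n] that by blast
      then show ?thesis
        by (intro eventually_mono[OF eventually_gt_at_top[of m]]) blast
    qed simp
  qed simp
  then have "\<forall>\<^sub>F n in sequentially. \<forall>u\<in>?U. \<forall>u'\<in>?U. \<forall>v\<in>?V. \<forall>v'\<in>?V.
      u + nat_multiple n v = u' + nat_multiple n v' \<longrightarrow> v = v'"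
    by (intro eventually_ball_finite finite_keys ballI) auto
  then show ?thesis
  proof eventually_elim
    case (elim n)
    show ?case
    proof (intro ballI)
      fix u v assume u: "u \<in> ?U" and v: "v \<in> ?V"
      have "g * spread n f = (\<Sum>u'\<in>?U. \<Sum>v'\<in>?V.
        Poly_Mapping.single (u' + nat_multiple n v')
          (Poly_Mapping.lookup g u' * Poly_Mapping.lookup f v' ^ n))"
        unfolding spread_def by (subst (1) sum_single_keys[of g, symmetric]) (simp add: sum_product mult_single)
      then have "Poly_Mapping.lookup (g * spread n f) (u + nat_multiple n v) =
        (\<Sum>u'\<in>?U. \<Sum>v'\<in>?V. (Poly_Mapping.lookup g u' * Poly_Mapping.lookup f v' ^ n
            when u' + nat_multiple n v' = u + nat_multiple n v))"
        by (simp add: lookup_sum lookup_single)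
      also have "\<dots> = (\<Sum>u'\<in>?U. \<Sum>v'\<in>?V. if u' = u then if v' = v
          then Poly_Mapping.lookup g u * Poly_Mapping.lookup f v ^ n else 0 else 0)"
        using elim u v by (intro sum.cong refl) (auto simp: when_def)
      also have "\<dots> = (\<Sum>u'\<in>?U. if u' = u then Poly_Mapping.lookup g u * Poly_Mapping.lookup f v ^ n else 0)"
        using v by (intro sum.cong refl) auto
      also have "\<dots> = Poly_Mapping.lookup g u * Poly_Mapping.lookup f v ^ n"
        using u by simp
      finally show "u + nat_multiple n v \<in> Poly_Mapping.keys (g * spread n f)"
        using u v by (simp add: in_keys_iff)
    qed
  qed
qed

section \<open>Membership in the tight closure\<close>

context noetherian_cring
begin

lemma tight_closure_l_closed:
  assumes I: "ideal I R" and r: "r \<in> carrier R" and x: "x \<in> tight_closure R p I"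
  shows "r \<otimes> x \<in> tight_closure R p I"
proof -
  obtain c where c: "c \<in> off_minimal_primes R" and xc: "x \<in> carrier R"
    and ev: "\<forall>\<^sub>F e in sequentially. c \<otimes> x [^] (p ^ e) \<in> frobenius_power R I (p ^ e)"
    using x unfolding tight_closure_def by blast
  have cc: "c \<in> carrier R" using c by (simp add: off_minimal_primes_def)
  have "\<forall>\<^sub>F e in sequentially. c \<otimes> (r \<otimes> x) [^] (p ^ e) \<in> frobenius_power R I (p ^ e)"
    using ev
  proof eventually_elim
    case (elim e)
    have "r [^] (p ^ e) \<otimes> (c \<otimes> x [^] (p ^ e)) \<in> frobenius_power R I (p ^ e)"
      using r by (intro ideal.I_l_closed[OF frobenius_power_ideal[OF I] elim]) simp
    then show ?case using r xc cc by (simp add: nat_pow_distrib m_ac)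
  qed
  then show ?thesis using c r xc unfolding tight_closure_def by blast
qed

lemma zero_in_tight_closure:
  assumes p: "Factorial_Ring.prime p" and I: "ideal I R"
  shows "\<zero> \<in> tight_closure R p I"
proof -
  have one: "\<one> \<in> off_minimal_primes R"
    unfolding off_minimal_primes_def
    using ideal.one_imp_carrier primeideal.I_notcarr primeideal.axioms(1) minimal_primesD by fastforce
  have "p ^ e \<noteq> 0" for e using prime_gt_0_nat[OF p] by simp
  then have "\<one> \<otimes> \<zero> [^] (p ^ e) \<in> frobenius_power R I (p ^ e)" for e
    using frobenius_power_ideal[OF I]
    by (simp add: nat_pow_zero additive_subgroup.zero_closed ideal.axioms(1))
  then show ?thesis using one unfolding tight_closure_def
    by (intro CollectI conjI zero_closed bexI[of _ \<one>] always_eventually allI)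
qed

lemma tight_closure_finsum:
  assumes p: "Factorial_Ring.prime p" "has_characteristic R p" and I: "ideal I R"
    and F: "finite F" "\<And>i. i \<in> F \<Longrightarrow> f i \<in> tight_closure R p I"
  shows "(\<Oplus>i\<in>F. f i) \<in> tight_closure R p I"
  using F
proof (induction F rule: finite_induct)
  case empty
  then show ?case using zero_in_tight_closure[OF p(1) I] by simp
next
  case (insert a F)
  have "f i \<in> carrier R" if "i \<in> insert a F" for i
    using insert.prems[OF that] by (simp add: tight_closure_def)
  then have "(\<Oplus>i\<in>insert a F. f i) = f a \<oplus> (\<Oplus>i\<in>F. f i)"
    using insert.hyps by (intro finsum_insert) auto
  then show ?case using tight_closure_add[OF p I] insert by simp
qed

end

context cring
begin

text \<open>If \<open>z\<^sup>N\<close> is a multiple of \<open>y\<^sup>N\<close>, then every power of \<open>z\<close> is, up to the fixed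
factor \<open>y\<^sup>N\<close>, a multiple of the same power of \<open>y\<close>: divide \<open>q\<close> by \<open>N\<close> with remainder.\<close>

lemma frobenius_power_if_power_multiple:
  assumes I: "ideal I R" and y: "y \<in> I" and z: "z \<in> carrier R" and w: "w \<in> carrier R"
    and N: "0 < N" and eq: "z [^] (N::nat) = y [^] N \<otimes> w"
  shows "y [^] N \<otimes> z [^] q \<in> frobenius_power R I q"
proof -
  have yc: "y \<in> carrier R" using ideal.Icarr[OF I y] .
  let ?k = "q div N" and ?r = "q mod N"
  have r: "?r < N" using N by simp
  have "z [^] q = (z [^] N) [^] ?k \<otimes> z [^] ?r" using z by (simp add: nat_pow_pow nat_pow_mult)
  also have "\<dots> = y [^] (N * ?k) \<otimes> w [^] ?k \<otimes> z [^] ?r"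
    using yc w by (simp add: eq nat_pow_distrib nat_pow_pow)
  finally have "y [^] N \<otimes> z [^] q = (y [^] N \<otimes> y [^] (N * ?k)) \<otimes> (w [^] ?k \<otimes> z [^] ?r)"
    using yc w z by (simp add: m_assoc)
  also have "y [^] N \<otimes> y [^] (N * ?k) = y [^] q \<otimes> y [^] (N - ?r)"
  proof -
    have "N + N * ?k = q + (N - ?r)" using mult_div_mod_eq[of N q] r by linarith
    then show ?thesis using yc by (simp add: nat_pow_mult)
  qed
  also have "y [^] q \<otimes> y [^] (N - ?r) \<otimes> (w [^] ?k \<otimes> z [^] ?r) = y [^] q \<otimes> (y [^] (N - ?r) \<otimes> (w [^] ?k \<otimes> z [^] ?r))"
    using yc w z by (simp add: m_assoc)
  also have "\<dots> \<in> frobenius_power R I q"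
  proof (rule ideal.I_r_closed[OF frobenius_power_ideal[OF I]])
    show "y [^] q \<in> frobenius_power R I q"
      unfolding frobenius_power_def using y ideal.Icarr[OF I] by (intro genideal_self[THEN subsetD]) auto
  qed (use yc w z in auto)
  finally show ?thesis .
qed

end

lemma (in domain) off_minimal_primes_domain: "off_minimal_primes R = carrier R - {\<zero>}"
proof -
  have "minimal_primes R = {{\<zero>}}"
    unfolding minimal_primes_def
    using zeroprimeideal additive_subgroup.zero_closed[OF ideal.axioms(1)[OF primeideal.axioms(1)]]
    by fastforce
  then show ?thesis unfolding off_minimal_primes_def by simp
qed

section \<open>Rings presented as semigroup rings\<close>

locale semigroup_presentation = noetherian_cring R for R (structure) +
  fixes A S :: "'g::{ordered_cancel_comm_monoid_add, linorder} set"
    and h :: "('g \<Rightarrow>\<^sub>0 'k::field) \<Rightarrow> 'a"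
  assumes finite_A: "finite A"
    and S_generated: "S = {sum_mset W | W. set_mset W \<subseteq> A}"
    and iso: "h \<in> ring_iso (semigroup_ring S) R"
begin

definition monomial :: "'g \<Rightarrow> 'a" where "monomial v = h (Poly_Mapping.single v 1)"

lemma zero_in_S [simp]: "0 \<in> S"
  unfolding S_generated by (intro CollectI exI[of _ "{#}"]) simp

lemma add_in_S [simp]: "u \<in> S \<Longrightarrow> v \<in> S \<Longrightarrow> u + v \<in> S"
  unfolding S_generated by (auto simp: sum_mset.union[symmetric] simp del: sum_mset.union)
    (metis Un_least set_mset_union)

lemma sum_mset_in_S: "set_mset G \<subseteq> S \<Longrightarrow> sum_mset G \<in> S"
  by (induction G) auto

lemma nat_multiple_in_S [simp]: "v \<in> S \<Longrightarrow> nat_multiple n v \<in> S"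
  unfolding nat_multiple_def by (intro sum_mset_in_S) auto

lemma keys_mult_S: "Poly_Mapping.keys f \<subseteq> S \<Longrightarrow> Poly_Mapping.keys g \<subseteq> S \<Longrightarrow> Poly_Mapping.keys (f * g) \<subseteq> S"
  using keys_mult[of f g] by fastforce

lemma h_closed: "Poly_Mapping.keys f \<subseteq> S \<Longrightarrow> h f \<in> carrier R"
  using ring_iso_memE(1)[OF iso] by (simp add: semigroup_ring_def)

lemma h_mult: "Poly_Mapping.keys f \<subseteq> S \<Longrightarrow> Poly_Mapping.keys g \<subseteq> S \<Longrightarrow> h (f * g) = h f \<otimes> h g"
  using ring_iso_memE(2)[OF iso] by (simp add: semigroup_ring_def)

lemma h_add: "Poly_Mapping.keys f \<subseteq> S \<Longrightarrow> Poly_Mapping.keys g \<subseteq> S \<Longrightarrow> h (f + g) = h f \<oplus> h g"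
  using ring_iso_memE(3)[OF iso] by (simp add: semigroup_ring_def)

lemma h_one: "h 1 = \<one>"
  using ring_iso_memE(4)[OF iso] by (simp add: semigroup_ring_def)

lemma h_bij: "bij_betw h {f. Poly_Mapping.keys f \<subseteq> S} (carrier R)"
  using ring_iso_memE(5)[OF iso] by (simp add: semigroup_ring_def)

lemma h_inj: "Poly_Mapping.keys f \<subseteq> S \<Longrightarrow> Poly_Mapping.keys g \<subseteq> S \<Longrightarrow> h f = h g \<Longrightarrow> f = g"
  using h_bij by (auto simp: bij_betw_def inj_on_def)

lemma h_surj: "x \<in> carrier R \<Longrightarrow> \<exists>f. Poly_Mapping.keys f \<subseteq> S \<and> h f = x"
  using h_bij by (force simp: bij_betw_def)

lemma h_zero: "h 0 = \<zero>"
  using h_add[of 0 0] h_closed[of 0] by simp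

lemma h_sum:
  assumes "finite F" "\<And>i. i \<in> F \<Longrightarrow> Poly_Mapping.keys (f i) \<subseteq> S"
  shows "h (\<Sum>i\<in>F. f i) = (\<Oplus>i\<in>F. h (f i))"
  using assms
proof (induction F rule: finite_induct)
  case empty
  then show ?case by (simp add: h_zero)
next
  case (insert a F)
  have "Poly_Mapping.keys (\<Sum>i\<in>F. f i) \<subseteq> S"
    using keys_sum[of f F] insert.prems by fastforce
  then show ?case using insert by (simp add: h_add h_closed Pi_iff)
qed

lemma h_power: "Poly_Mapping.keys f \<subseteq> S \<Longrightarrow> Poly_Mapping.keys (f ^ n) \<subseteq> S \<and> h (f ^ n) = h f [^] n"
proof (induction n)
  case (Suc n)
  then show ?case
    using keys_mult_S[of f "f ^ n"] by (simp add: h_mult h_closed m_comm)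
qed (simp add: h_one)

lemma presentation_domain: "domain R"
proof (rule domain.intro[OF is_cring], unfold_locales)
  show "\<one> \<noteq> \<zero>" using h_inj[of 1 0] h_one h_zero by auto
  fix a b assume ab: "a \<otimes> b = \<zero>" "a \<in> carrier R" "b \<in> carrier R"
  obtain f g where "Poly_Mapping.keys f \<subseteq> S" "h f = a" "Poly_Mapping.keys g \<subseteq> S" "h g = b"
    using h_surj ab(2,3) by metis
  then have "h (f * g) = h 0" "Poly_Mapping.keys (f * g) \<subseteq> S"
    using ab(1) h_mult h_zero keys_mult_S by (metis, metis)
  then have "f * g = 0" using h_inj[of "f * g" 0] by simp
  then show "a = \<zero> \<or> b = \<zero>"
    using \<open>h f = a\<close> \<open>h g = b\<close> h_zero by (metis mult_eq_0_iff)
qed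

lemma monomial_closed [simp]: "v \<in> S \<Longrightarrow> monomial v \<in> carrier R"
  unfolding monomial_def by (intro h_closed) simp

lemma monomial_0: "monomial 0 = \<one>"
  unfolding monomial_def by (simp add: h_one)

lemma monomial_add: "v \<in> S \<Longrightarrow> w \<in> S \<Longrightarrow> monomial (v + w) = monomial v \<otimes> monomial w"
  unfolding monomial_def by (subst h_mult[symmetric]) (auto simp: mult_single)

lemma monomial_nat_multiple: "v \<in> S \<Longrightarrow> monomial (nat_multiple n v) = monomial v [^] n"
  by (induction n) (auto simp: monomial_0 nat_multiple_Suc monomial_add m_comm)

lemma monomial_nonzero: "v \<in> S \<Longrightarrow> monomial v \<noteq> \<zero>"
  proof
  assume v: "v \<in> S" "monomial v = \<zero>"
  then have "Poly_Mapping.single v (1::'k) = 0"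
    using h_zero by (intro h_inj) (auto simp: monomial_def)
  then show False by (metis lookup_single_eq lookup_zero one_neq_zero)
qed

lemma h_single: "v \<in> S \<Longrightarrow> h (Poly_Mapping.single v k) = h (Poly_Mapping.single 0 k) \<otimes> monomial v"
  unfolding monomial_def by (subst h_mult[symmetric]) (auto simp: mult_single)

lemma h_eq_sum_monomials:
  assumes "Poly_Mapping.keys f \<subseteq> S"
  shows "h f = (\<Oplus>v\<in>Poly_Mapping.keys f. h (Poly_Mapping.single 0 (Poly_Mapping.lookup f v)) \<otimes> monomial v)"
proof -
  have "h f = h (\<Sum>v\<in>Poly_Mapping.keys f. Poly_Mapping.single v (Poly_Mapping.lookup f v))"
    by (simp add: sum_single_keys)
  also have "\<dots> = (\<Oplus>v\<in>Poly_Mapping.keys f. h (Poly_Mapping.single v (Poly_Mapping.lookup f v)))"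
    using assms by (intro h_sum) auto
  also have "\<dots> = (\<Oplus>v\<in>Poly_Mapping.keys f. h (Poly_Mapping.single 0 (Poly_Mapping.lookup f v)) \<otimes> monomial v)"
    using assms by (intro finsum_cong' h_single) (auto intro!: h_closed m_closed monomial_closed split: if_splits)
  finally show ?thesis .
qed

lemma h_spread:
  assumes p: "Factorial_Ring.prime p" "has_characteristic R p" and f: "Poly_Mapping.keys f \<subseteq> S"
  shows "h f [^] (p ^ e) = h (spread (p ^ e) f)" and "Poly_Mapping.keys (spread (p ^ e) f) \<subseteq> S"
proof -
  let ?t = "\<lambda>v. Poly_Mapping.single v (Poly_Mapping.lookup f v)"
  have pow: "?t v ^ n = Poly_Mapping.single (nat_multiple n v) (Poly_Mapping.lookup f v ^ n)" for v n
    by (induction n) (auto simp: nat_multiple_Suc mult_single)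
  have t: "Poly_Mapping.keys (?t v) \<subseteq> S" if "v \<in> Poly_Mapping.keys f" for v
    using f that by auto
  have "h f [^] (p ^ e) = h (\<Sum>v\<in>Poly_Mapping.keys f. ?t v) [^] (p ^ e)" by (simp add: sum_single_keys)
  also have "\<dots> = (\<Oplus>v\<in>Poly_Mapping.keys f. h (?t v)) [^] (p ^ e)"
    using t by (subst h_sum) auto
  also have "\<dots> = (\<Oplus>v\<in>Poly_Mapping.keys f. h (?t v) [^] (p ^ e))"
    using t by (intro frobenius_finsum p) (auto intro: h_closed simp del: keys_single)
  also have "\<dots> = (\<Oplus>v\<in>Poly_Mapping.keys f. h (?t v ^ (p ^ e)))"
    using h_power[OF t] by (intro finsum_cong') (auto intro!: h_closed simp del: keys_single)
  also have "\<dots> = h (\<Sum>v\<in>Poly_Mapping.keys f. ?t v ^ (p ^ e))"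
    using h_power[OF t] by (intro h_sum[symmetric]) auto
  finally show "h f [^] (p ^ e) = h (spread (p ^ e) f)" by (simp add: pow spread_def)
  show "Poly_Mapping.keys (spread (p ^ e) f) \<subseteq> S"
    unfolding spread_def using f
    by (intro order_trans[OF keys_sum]) (auto split: if_splits)
qed

text \<open>The monomial ideal of the monomials with exponents in \<open>E + S\<close>, described by supports. Containment of
an ideal in it turns membership of a ring element into a statement on exponents.\<close>

definition monomial_span :: "'g set \<Rightarrow> 'a set" where
  "monomial_span E = h ` {f. Poly_Mapping.keys f \<subseteq> {e + w | e w. e \<in> E \<and> w \<in> S}}"

lemma translates_in_S: "E \<subseteq> S \<Longrightarrow> {e + w | e w. e \<in> E \<and> w \<in> S} \<subseteq> S"
  by auto

lemma monomial_span_ideal: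
  assumes E: "E \<subseteq> S"
  shows "ideal (monomial_span E) R"
proof (rule idealI[OF ring_axioms])
  let ?T = "{e + w | e w. e \<in> E \<and> w \<in> S}"
  note T = translates_in_S[OF E]
  show l: "x \<otimes> z \<in> monomial_span E" if z: "z \<in> monomial_span E" and x: "x \<in> carrier R" for z x
  proof -
    obtain f where f: "Poly_Mapping.keys f \<subseteq> ?T" "z = h f" using z unfolding monomial_span_def by blast
    obtain g where g: "Poly_Mapping.keys g \<subseteq> S" "h g = x" using h_surj[OF x] by blast
    have "Poly_Mapping.keys (g * f) \<subseteq> ?T"
    proof
      fix k assume "k \<in> Poly_Mapping.keys (g * f)"
      then obtain a b where ab: "k = a + b" "a \<in> Poly_Mapping.keys g" "b \<in> Poly_Mapping.keys f"
        using keys_mult[of g f] by blast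
      then obtain e w where "b = e + w" "e \<in> E" "w \<in> S" using f(1) by blast
      then have "k = e + (a + w)" "a + w \<in> S" using ab g(1) by (auto simp: add_ac)
      then show "k \<in> ?T" using \<open>e \<in> E\<close> by blast
    qed
    moreover have "x \<otimes> z = h (g * f)" using f g T by (simp add: h_mult)
    ultimately show ?thesis unfolding monomial_span_def by blast
  qed
  have c: "monomial_span E \<subseteq> carrier R" using T h_closed unfolding monomial_span_def by blast
  show "z \<otimes> x \<in> monomial_span E" if "z \<in> monomial_span E" "x \<in> carrier R" for z x
    using l[OF that] that c by (metis m_comm subsetD)
  show "subgroup (monomial_span E) (add_monoid R)"
  proof (rule add.subgroupI)
    show "monomial_span E \<subseteq> carrier R" by fact
    have "h 0 \<in> monomial_span E" unfolding monomial_span_def by (intro imageI) simp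
    then show "monomial_span E \<noteq> {}" by blast
    show "\<ominus> z \<in> monomial_span E" if "z \<in> monomial_span E" for z
    proof -
      have "z \<in> carrier R" using that c by blast
      then show ?thesis using l[OF that, of "\<ominus> \<one>"] by (simp add: l_minus)
    qed
    fix z w assume "z \<in> monomial_span E" "w \<in> monomial_span E"
    then obtain f g where f: "Poly_Mapping.keys f \<subseteq> ?T" "z = h f" "Poly_Mapping.keys g \<subseteq> ?T" "w = h g"
      unfolding monomial_span_def by blast
    have "Poly_Mapping.keys (f + g) \<subseteq> ?T" using keys_add[of f g] f(1,3) by blast
    moreover have "z \<oplus> w = h (f + g)"
      unfolding f(2,4) using f(1,3) T by (intro h_add[symmetric]) auto
    ultimately show "z \<oplus> w \<in> monomial_span E" unfolding monomial_span_def by blast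
  qed
qed

lemma keys_if_in_monomial_span:
  assumes "E \<subseteq> S" "Poly_Mapping.keys f \<subseteq> S" "h f \<in> monomial_span E" "k \<in> Poly_Mapping.keys f"
  shows "\<exists>e\<in>E. \<exists>w\<in>S. k = e + w"
proof -
  obtain g where g: "Poly_Mapping.keys g \<subseteq> {e + w | e w. e \<in> E \<and> w \<in> S}" "h f = h g"
    using assms(3) unfolding monomial_span_def by blast
  then have "f = g" using h_inj[OF assms(2)] translates_in_S[OF assms(1)] by blast
  then show ?thesis using g(1) assms(4) by blast
qed

lemma monomial_in_monomial_span: "e \<in> E \<Longrightarrow> monomial e \<in> monomial_span E"
  unfolding monomial_def monomial_span_def using zero_in_S
  by (intro imageI) (force intro: add_0_right[symmetric])

lemma monomial_span_mono: "E \<subseteq> E' \<Longrightarrow> monomial_span E \<subseteq> monomial_span E'"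
  unfolding monomial_span_def by (intro image_mono) blast

lemma monomial_span_mult:
  assumes E: "E \<subseteq> S" "E' \<subseteq> S" and sum: "\<And>e e'. e \<in> E \<Longrightarrow> e' \<in> E' \<Longrightarrow> e + e' \<in> E''"
    and z: "z \<in> monomial_span E" "z' \<in> monomial_span E'"
  shows "z \<otimes> z' \<in> monomial_span E''"
proof -
  let ?T = "\<lambda>E. {e + w | e w. e \<in> E \<and> w \<in> S}"
  obtain f g where f: "Poly_Mapping.keys f \<subseteq> ?T E" "z = h f" "Poly_Mapping.keys g \<subseteq> ?T E'" "z' = h g"
    using z unfolding monomial_span_def by blast
  have "Poly_Mapping.keys (f * g) \<subseteq> ?T E''"
  proof
    fix k assume "k \<in> Poly_Mapping.keys (f * g)"
    then obtain a b where ab: "k = a + b" "a \<in> Poly_Mapping.keys f" "b \<in> Poly_Mapping.keys g"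
      using keys_mult[of f g] by blast
    then obtain e w e' w' where "a = e + w" "b = e' + w'" "e \<in> E" "w \<in> S" "e' \<in> E'" "w' \<in> S"
      using f(1,3) by blast
    then have "k = (e + e') + (w + w')" "w + w' \<in> S" "e + e' \<in> E''"
      using ab(1) sum[of e e'] by (auto simp only: add_ac add_in_S)
    then show "k \<in> ?T E''" by blast
  qed
  moreover have "z \<otimes> z' = h (f * g)"
    unfolding f(2,4) using f(1,3) translates_in_S[OF E(1)] translates_in_S[OF E(2)]
    by (intro h_mult[symmetric]) auto
  ultimately show ?thesis unfolding monomial_span_def by blast
qed

end

section \<open>The weak closure of a monomial ideal\<close>

locale monomial_ideal_presentation = semigroup_presentation R A S h
  for R :: "('a, 'm) ring_scheme" (structure) and A S :: "'g::{ordered_cancel_comm_monoid_add, linorder} set"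
    and h :: "('g \<Rightarrow>\<^sub>0 'k::field) \<Rightarrow> 'a" +
  fixes I M
  assumes M_subset: "M \<subseteq> S" and finite_M: "finite M" and I_eq: "I = Idl (monomial ` M)"
begin

lemma I_ideal: "ideal I R"
  unfolding I_eq using M_subset by (intro genideal_ideal) auto

lemma generator_in_I: "g \<in> M \<Longrightarrow> monomial g \<in> I"
  unfolding I_eq using M_subset by (intro genideal_self[THEN subsetD]) auto

lemma I_subset_span: "I \<subseteq> monomial_span M"
  unfolding I_eq using monomial_in_monomial_span
  by (intro genideal_minimal monomial_span_ideal M_subset) auto

lemma sum_generators_in_S: "set_mset G \<subseteq> M \<Longrightarrow> sum_mset G \<in> S"
  using M_subset by (intro sum_mset_in_S) auto

lemma sum_generators_in_ideal_power: "set_mset G \<subseteq> M \<Longrightarrow> monomial (sum_mset G) \<in> ideal_power R I (size G)"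
proof (induction G)
  case empty
  then show ?case by (simp add: monomial_0)
next
  case (add g G)
  then have "monomial (sum_mset G) \<otimes> monomial g \<in> ideal_prod R (ideal_power R I (size G)) I"
    using generator_in_I by (intro ideal_prod.prod) auto
  moreover have "monomial (sum_mset (add_mset g G)) = monomial (sum_mset G) \<otimes> monomial g"
    using add.prems M_subset sum_generators_in_S[of G] monomial_add[of "sum_mset G" g] by (auto simp: add.commute)
  ultimately show ?case by (simp add: ideal_power_Suc)
qed

lemma ideal_power_subset_span:
  "ideal_power R I n \<subseteq> monomial_span (sum_mset ` multisets_of_size M n)"
proof (induction n)
  case 0
  show ?case
  proof
    fix x assume "x \<in> ideal_power R I 0"
    then obtain f where "Poly_Mapping.keys f \<subseteq> S" "h f = x" using h_surj by auto
    then show "x \<in> monomial_span (sum_mset ` multisets_of_size M 0)"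
      unfolding monomial_span_def by auto
  qed
next
  case (Suc n)
  have E: "sum_mset ` multisets_of_size M k \<subseteq> S" for k
    using sum_generators_in_S by (auto simp: multisets_of_size_def)
  show ?case
  proof
    fix x assume "x \<in> ideal_power R I (Suc n)"
    then have "x \<in> ideal_prod R (ideal_power R I n) I" by (simp add: ideal_power_Suc)
    then show "x \<in> monomial_span (sum_mset ` multisets_of_size M (Suc n))"
    proof (induction rule: ideal_prod.induct)
      case (prod i j)
      show ?case
      proof (rule monomial_span_mult[OF E M_subset])
        show "i \<in> monomial_span (sum_mset ` multisets_of_size M n)" using Suc prod(1) by blast
        show "j \<in> monomial_span M" using I_subset_span prod(2) by blast
        fix e e' assume "e \<in> sum_mset ` multisets_of_size M n" "e' \<in> M"
        then obtain G where "set_mset G \<subseteq> M" "size G = n" "e = sum_mset G"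
          by (auto simp: multisets_of_size_def)
        then show "e + e' \<in> sum_mset ` multisets_of_size M (Suc n)"
          using \<open>e' \<in> M\<close> by (intro image_eqI[of _ _ "add_mset e' G"]) (auto simp: multisets_of_size_def add.commute)
      qed
    next
      case (sum s t)
      then show ?case
        using monomial_span_ideal[OF E] by (simp add: additive_subgroup.a_closed ideal.axioms(1))
    qed
  qed
qed

lemma frobenius_power_subset_span:
  assumes p: "Factorial_Ring.prime p" "has_characteristic R p"
  shows "frobenius_power R I (p ^ e) \<subseteq> monomial_span (nat_multiple (p ^ e) ` M)"
proof -
  have E: "nat_multiple (p ^ e) ` M \<subseteq> S" using M_subset by auto
  have "f [^] (p ^ e) \<in> monomial_span (nat_multiple (p ^ e) ` M)" if f: "f \<in> I" for f
  proof -
    obtain g where g: "Poly_Mapping.keys g \<subseteq> {m + w | m w. m \<in> M \<and> w \<in> S}" "f = h g"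
      using f I_subset_span unfolding monomial_span_def by blast
    have gS: "Poly_Mapping.keys g \<subseteq> S" using g(1) translates_in_S[OF M_subset] by blast
    have "Poly_Mapping.keys (spread (p ^ e) g) \<subseteq> {m + w | m w. m \<in> nat_multiple (p ^ e) ` M \<and> w \<in> S}"
    proof
      fix k assume "k \<in> Poly_Mapping.keys (spread (p ^ e) g)"
      then obtain v where v: "v \<in> Poly_Mapping.keys g" "k = nat_multiple (p ^ e) v"
        unfolding spread_def using keys_sum by (fastforce split: if_splits)
      then obtain m w where mw: "v = m + w" "m \<in> M" "w \<in> S" using g(1) by blast
      then have "k = nat_multiple (p ^ e) m + nat_multiple (p ^ e) w" "nat_multiple (p ^ e) w \<in> S"
        using v(2) by (auto simp: nat_multiple_add)
      then show "k \<in> {m + w | m w. m \<in> nat_multiple (p ^ e) ` M \<and> w \<in> S}" using mw(2) by blast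
    qed
    then show ?thesis
      unfolding g(2) h_spread(1)[OF p gS] monomial_span_def by blast
  qed
  then show ?thesis
    unfolding frobenius_power_def by (intro genideal_minimal monomial_span_ideal E) auto
qed

lemma mixed_power_subset_span:
  assumes p: "Factorial_Ring.prime p" "has_characteristic R p"
  shows "mixed_power R I s (p ^ e) \<subseteq> monomial_span (sum_mset ` (multisets_of_size M (nat \<lceil>s * real (p ^ e)\<rceil>)
    \<union> replicate_mset (p ^ e) ` M))" (is "_ \<subseteq> monomial_span ?E")
proof -
  have E: "?E \<subseteq> S"
    using sum_generators_in_S M_subset by (auto simp: multisets_of_size_def nat_multiple_def[symmetric])
  have 1: "ideal_power R I (nat \<lceil>s * real (p ^ e)\<rceil>) \<subseteq> monomial_span ?E"
    by (rule order_trans[OF ideal_power_subset_span monomial_span_mono]) blast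
  have 2: "frobenius_power R I (p ^ e) \<subseteq> monomial_span ?E"
    by (rule order_trans[OF frobenius_power_subset_span[OF p] monomial_span_mono])
      (auto simp: nat_multiple_def)
  show ?thesis
    unfolding mixed_power_def set_add_def'
    using 1 2 additive_subgroup.a_closed[OF ideal.axioms(1)[OF monomial_span_ideal[OF E]]] by blast
qed

text \<open>With \<open>u\<close> in the support of the multiplier \<open>c\<close>, the monomial \<open>u + q v\<close> survives in \<open>c x\<^sup>q\<close> for large
\<open>q\<close>, and the mixed power is contained in a monomial ideal. Thus one \<open>u\<close> serves all monomials \<open>v\<close> of
\<open>x\<close> and all large \<open>q\<close>.\<close>

lemma weak_closure_exponents:
  assumes p: "Factorial_Ring.prime p" "has_characteristic R p"
    and f: "Poly_Mapping.keys f \<subseteq> S" "h f \<in> weak_closure R p s I"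
  shows "\<exists>u. \<forall>v\<in>Poly_Mapping.keys f. \<forall>\<^sub>F e in sequentially. \<exists>G W. set_mset G \<subseteq> M \<and> set_mset W \<subseteq> A
    \<and> u + nat_multiple (p ^ e) v = sum_mset G + sum_mset W
    \<and> (size G = nat \<lceil>s * real (p ^ e)\<rceil> \<or> (\<exists>g. G = replicate_mset (p ^ e) g))"
proof -
  interpret domain R by (rule presentation_domain)
  obtain c where c: "c \<in> carrier R - {\<zero>}"
    and ev: "\<forall>\<^sub>F e in sequentially. c \<otimes> h f [^] (p ^ e) \<in> mixed_power R I s (p ^ e)"
    using f(2) unfolding weak_closure_def off_minimal_primes_domain by blast
  obtain g where g: "Poly_Mapping.keys g \<subseteq> S" "h g = c" using h_surj c by blast
  have "g \<noteq> 0" using c g(2) h_zero by auto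
  then obtain u where u: "u \<in> Poly_Mapping.keys g" by (metis keys_eq_empty ex_in_conv)
  have "filterlim (\<lambda>e. p ^ e) sequentially sequentially"
  proof (rule filterlim_at_top_mono[OF filterlim_ident])
    show "\<forall>\<^sub>F e in sequentially. e \<le> p ^ e"
      using prime_gt_1_nat[OF p(1)] by (intro always_eventually allI less_imp_le power_gt_expt) auto
  qed
  from eventually_compose_filterlim[OF eventually_keys_spread_mult[of g f] this]
  have "\<forall>\<^sub>F e in sequentially. \<forall>v\<in>Poly_Mapping.keys f. \<exists>G W. set_mset G \<subseteq> M \<and> set_mset W \<subseteq> A
    \<and> u + nat_multiple (p ^ e) v = sum_mset G + sum_mset W
    \<and> (size G = nat \<lceil>s * real (p ^ e)\<rceil> \<or> (\<exists>g. G = replicate_mset (p ^ e) g))"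
    using ev
  proof eventually_elim
    case (elim e)
    let ?E = "multisets_of_size M (nat \<lceil>s * real (p ^ e)\<rceil>) \<union> replicate_mset (p ^ e) ` M"
    have E: "sum_mset ` ?E \<subseteq> S" and EM: "\<And>G. G \<in> ?E \<Longrightarrow> set_mset G \<subseteq> M"
      using sum_generators_in_S M_subset
      by (auto simp: multisets_of_size_def nat_multiple_def[symmetric] split: if_splits)
    have "h (g * spread (p ^ e) f) = c \<otimes> h f [^] (p ^ e)"
      using g h_spread[OF p f(1)] by (simp add: h_mult)
    then have in_span: "h (g * spread (p ^ e) f) \<in> monomial_span (sum_mset ` ?E)"
      using elim(2) mixed_power_subset_span[OF p] by auto
    have gf: "Poly_Mapping.keys (g * spread (p ^ e) f) \<subseteq> S"
      by (intro keys_mult_S g h_spread(2)[OF p f(1)])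
    show ?case
    proof
      fix v assume "v \<in> Poly_Mapping.keys f"
      then obtain G w where G: "G \<in> ?E" "w \<in> S" "u + nat_multiple (p ^ e) v = sum_mset G + w"
        using keys_if_in_monomial_span[OF E gf in_span] elim(1) u by blast
      obtain W where "w = sum_mset W" "set_mset W \<subseteq> A" using G(2) S_generated by blast
      moreover have "size G = nat \<lceil>s * real (p ^ e)\<rceil> \<or> (\<exists>g. G = replicate_mset (p ^ e) g)"
        using G(1) by (auto simp: multisets_of_size_def)
      ultimately show "\<exists>G W. set_mset G \<subseteq> M \<and> set_mset W \<subseteq> A
          \<and> u + nat_multiple (p ^ e) v = sum_mset G + sum_mset W
          \<and> (size G = nat \<lceil>s * real (p ^ e)\<rceil> \<or> (\<exists>g. G = replicate_mset (p ^ e) g))"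
        using G EM by blast
    qed
  qed
  then show ?thesis
    by (intro exI[of _ u] ballI) (auto elim: eventually_mono)
qed

text \<open>The two alternatives say that the monomial of \<open>v\<close> lies in the tight closure or in the rational
power. The first is proved if the Frobenius power accounts for
infinitely many \<open>q\<close>, the second otherwise; in either case comparing two values of \<open>q\<close> removes the translation by \<open>u\<close>.\<close>

lemma exponent_dichotomy:
  fixes a b :: nat
  assumes p: "Factorial_Ring.prime p" and b: "0 < b"
    and ev: "\<forall>\<^sub>F e in sequentially. \<exists>G W. set_mset G \<subseteq> M \<and> set_mset W \<subseteq> A
    \<and> u + nat_multiple (p ^ e) v = sum_mset G + sum_mset W
    \<and> (size G = nat \<lceil>real a / real b * real (p ^ e)\<rceil> \<or> (\<exists>g. G = replicate_mset (p ^ e) g))"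
  shows "(\<exists>N>0. \<exists>g\<in>M. \<exists>w\<in>S. nat_multiple N v = nat_multiple N g + w)
    \<or> (\<exists>N>0. \<exists>G w. set_mset G \<subseteq> M \<and> size G = a * N \<and> w \<in> S \<and> nat_multiple (b * N) v = sum_mset G + w)"
proof -
  let ?c = "\<lambda>q. nat \<lceil>real a / real b * real q\<rceil>"
  obtain e0 where "\<forall>e\<ge>e0. \<exists>G W. set_mset G \<subseteq> M \<and> set_mset W \<subseteq> A
    \<and> u + nat_multiple (p ^ e) v = sum_mset G + sum_mset W
    \<and> (size G = ?c (p ^ e) \<or> (\<exists>g. G = replicate_mset (p ^ e) g))"
    using ev unfolding eventually_sequentially by blast
  then obtain G W where GW: "\<And>e. e0 \<le> e \<Longrightarrow> set_mset (G e) \<subseteq> M"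
    "\<And>e. e0 \<le> e \<Longrightarrow> set_mset (W e) \<subseteq> A"
    "\<And>e. e0 \<le> e \<Longrightarrow> u + nat_multiple (p ^ e) v = sum_mset (G e) + sum_mset (W e)"
    "\<And>e. e0 \<le> e \<Longrightarrow> size (G e) = ?c (p ^ e) \<or> (\<exists>g. G e = replicate_mset (p ^ e) g)"
    by metis
  have p1: "1 < p" using prime_gt_1_nat[OF p] .
  have two_times: "\<exists>i j Y. e0 \<le> i \<and> i < j \<and> i \<in> T \<and> j \<in> T \<and> p ^ i mod b = p ^ j mod b \<and> G i \<subseteq># G j \<and> set_mset Y \<subseteq> A
    \<and> nat_multiple (p ^ j - p ^ i) v = sum_mset (G j - G i) + sum_mset Y"
    if T: "infinite T" "\<And>e. e \<in> T \<Longrightarrow> e0 \<le> e" for T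
  proof -
    obtain r :: "nat \<Rightarrow> nat" where r: "strict_mono r" "\<And>n. r n \<in> T"
      using infinite_enumerate[OF T(1)] by blast
    have "strict_mono (\<lambda>n. p ^ r n)"
      using r(1) p1 by (simp add: strict_mono_def power_strict_increasing)
    from bounded_translate_dickson[OF finite_M finite_A this b, of "\<lambda>n. G (r n)" "\<lambda>n. W (r n)" u v]
    obtain i j Y where "i < j" "p ^ r i mod b = p ^ r j mod b" "G (r i) \<subseteq># G (r j)" "set_mset Y \<subseteq> A"
      "nat_multiple (p ^ r j - p ^ r i) v = sum_mset (G (r j) - G (r i)) + sum_mset Y"
      using GW(1-3) T(2) r(2) by blast
    then show ?thesis using r T(2) by (metis strict_mono_less)
  qed
  define T where "T = {e. e0 \<le> e \<and> (\<exists>g. G e = replicate_mset (p ^ e) g)}"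
  show ?thesis
  proof (cases "infinite T")
    case True
    obtain i j Y where ij: "i < j" "i \<in> T" "j \<in> T" "G i \<subseteq># G j" "set_mset Y \<subseteq> A"
      "nat_multiple (p ^ j - p ^ i) v = sum_mset (G j - G i) + sum_mset Y"
      using two_times[OF True] unfolding T_def by blast
    obtain g g' where g: "G i = replicate_mset (p ^ i) g" "G j = replicate_mset (p ^ j) g'"
      using ij(2,3) unfolding T_def by blast
    have "0 < p ^ i" using p1 by simp
    then have "g \<in># G i" unfolding g(1) by simp
    then have "g \<in># G j" using ij(4) mset_subset_eqD by fast
    then have "g' = g" unfolding g(2) by (simp split: if_splits)
    have "g \<in> M" using \<open>g \<in># G j\<close> GW(1) ij(3) unfolding T_def by blast
    \<comment> \<open>Both multisets are constant, and the smaller one is nonempty, so they repeat the same generator.\<close>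
    have "G j - G i = replicate_mset (p ^ j - p ^ i) g"
      unfolding g \<open>g' = g\<close> by (rule multiset_eqI) simp
    then have "nat_multiple (p ^ j - p ^ i) v = nat_multiple (p ^ j - p ^ i) g + sum_mset Y"
      using ij(6) by (simp add: nat_multiple_def)
    moreover have "0 < p ^ j - p ^ i" using ij(1) p1 by (simp add: power_strict_increasing)
    moreover have "sum_mset Y \<in> S" using ij(5) S_generated by blast
    ultimately show ?thesis using \<open>g \<in> M\<close> by blast
  next
    case False
    have "infinite ({e0..} - T)" using False infinite_Ici[of e0] by (metis Diff_infinite_finite)
    then obtain i j Y where ij: "e0 \<le> i" "i < j" "i \<notin> T" "j \<notin> T" "p ^ i mod b = p ^ j mod b"
      "G i \<subseteq># G j" "set_mset Y \<subseteq> A"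
      "nat_multiple (p ^ j - p ^ i) v = sum_mset (G j - G i) + sum_mset Y"
      using two_times[of "{e0..} - T"] by auto
    have lt: "p ^ i < p ^ j" using ij(2) p1 by (simp add: power_strict_increasing)
    then have "b dvd p ^ j - p ^ i" using ij(5) by (metis mod_eq_dvd_iff_nat less_imp_le)
    then obtain N where N: "p ^ j - p ^ i = b * N" by blast
    have "0 < N" using N lt by (cases N) auto
    have pj: "p ^ j = p ^ i + b * N" using N lt by simp
    have "real a / real b * real (p ^ j) = real a / real b * real (p ^ i) + real_of_int (int (a * N))"
      unfolding pj using b by (simp add: field_simps)
    then have "\<lceil>real a / real b * real (p ^ j)\<rceil> = \<lceil>real a / real b * real (p ^ i)\<rceil> + int (a * N)"
      by (simp only: ceiling_add_of_int)
    moreover have "0 \<le> \<lceil>real a / real b * real (p ^ i)\<rceil>"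
    proof -
      have "0 \<le> real a / real b * real (p ^ i)" by simp
      then show ?thesis by linarith
    qed
    ultimately have "?c (p ^ j) = ?c (p ^ i) + a * N" by linarith
    moreover have "size (G i) = ?c (p ^ i)" "size (G j) = ?c (p ^ j)"
      using GW(4)[of i] GW(4)[of j] ij(1-4) unfolding T_def by auto
    ultimately have "size (G j - G i) = a * N" using size_Diff_submset[OF ij(6)] by simp
    moreover have "set_mset (G j - G i) \<subseteq> M" using GW(1)[of j] ij(1,2) in_diffD by fastforce
    moreover have "sum_mset Y \<in> S" using ij(7) S_generated by blast
    ultimately show ?thesis using ij(8) \<open>0 < N\<close> N by metis
  qed
qed

lemma monomial_in_tight_closure:
  assumes N: "0 < N" and v: "v \<in> S" and g: "g \<in> M" and w: "w \<in> S"
    and eq: "nat_multiple N v = nat_multiple N g + w"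
  shows "monomial v \<in> tight_closure R p I"
proof -
  interpret domain R by (rule presentation_domain)
  have gS: "g \<in> S" using g M_subset by blast
  have "monomial v [^] N = monomial g [^] N \<otimes> monomial w"
    using eq v gS w by (metis monomial_add monomial_nat_multiple nat_multiple_in_S)
  from frobenius_power_if_power_multiple[OF I_ideal generator_in_I[OF g] _ _ N this] v w
  have "monomial g [^] N \<otimes> monomial v [^] (p ^ e) \<in> frobenius_power R I (p ^ e)" for e
    by simp
  moreover have "monomial g [^] N \<in> off_minimal_primes R"
    unfolding off_minimal_primes_domain
    using monomial_nonzero[of "nat_multiple N g"] gS by (simp add: monomial_nat_multiple)
  ultimately show ?thesis
    unfolding tight_closure_def using v
    by (intro CollectI conjI bexI[of _ "monomial g [^] N"] always_eventually allI) auto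
qed

text \<open>Integrality of a sum of monomials, each of which satisfies \<open>m\<^sup>B \<in> I\<^sup>a\<close>. The module
is spanned by the products of \<open>L\<close> of these monomials. Multiplication by \<open>x\<^sup>B\<close> leads to products of
\<open>L + B\<close> monomials, and \<open>L\<close> is so large that one monomial occurs \<open>B\<close> times in each of them; these \<open>B\<close>
factors yield an element of \<open>I\<^sup>a\<close> and leave a product of \<open>L\<close> monomials.\<close>

lemma sum_in_rational_power:
  assumes V: "finite V" "V \<subseteq> S" and B: "0 < B"
    and k: "\<And>v. v \<in> V \<Longrightarrow> k v \<in> carrier R"
    and mult: "\<And>v. v \<in> V \<Longrightarrow> \<exists>G w. set_mset G \<subseteq> M \<and> size G = a \<and> w \<in> S
      \<and> nat_multiple B v = sum_mset G + w"
  shows "(\<Oplus>v\<in>V. k v \<otimes> monomial v) [^] B \<in> integral_closure R (ideal_power R I a)"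
proof -
  interpret domain R by (rule presentation_domain)
  let ?x = "\<Oplus>v\<in>V. k v \<otimes> monomial v"
  define U where "U n = monomial ` sum_mset ` multisets_of_size V n" for n
  define L where "L = card V * B"
  let ?C = "linear_combinations R (U L) (\<lambda>_. ideal_power R I a) (\<lambda>u. u)"
  have VS: "sum_mset Y \<in> S" if "set_mset Y \<subseteq> V" for Y using that V(2) by (intro sum_mset_in_S) auto
  have Uc: "U n \<subseteq> carrier R" for n unfolding U_def using VS by (auto simp: multisets_of_size_def)
  have Ufin: "finite (U n)" for n unfolding U_def using V(1) by (intro finite_imageI finite_multisets_of_size)
  have J: "ideal (ideal_power R I a) R" by (intro ideal_power_ideal I_ideal)
  have xc: "?x \<in> carrier R" using k V(2) by (intro finsum_closed) auto
  have C: "ideal ?C R" using Ufin Uc J by (intro linear_combinations_ideal) auto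
  have step: "?x [^] n \<otimes> monomial (sum_mset Y) \<in> Idl (U (m + n))"
    if "set_mset Y \<subseteq> V" "size Y = m" for n m Y
    using that
  proof (induction n arbitrary: Y m)
    case 0
    then have "monomial (sum_mset Y) \<in> U m" unfolding U_def by (auto simp: multisets_of_size_def)
    then show ?case using genideal_self[OF Uc] VS[OF 0(1)] by auto
  next
    case (Suc n)
    have Yc: "monomial (sum_mset Y) \<in> carrier R" using VS[OF Suc.prems(1)] by simp
    have "?x [^] Suc n \<otimes> monomial (sum_mset Y) = ?x [^] n \<otimes> (?x \<otimes> monomial (sum_mset Y))"
      using xc Yc by (simp add: m_assoc)
    also have "?x \<otimes> monomial (sum_mset Y) = (\<Oplus>v\<in>V. (k v \<otimes> monomial v) \<otimes> monomial (sum_mset Y))"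
      using V k Yc by (intro finsum_ldistr) auto
    also have "?x [^] n \<otimes> \<dots> = (\<Oplus>v\<in>V. ?x [^] n \<otimes> ((k v \<otimes> monomial v) \<otimes> monomial (sum_mset Y)))"
      using V k Yc xc by (intro finsum_rdistr) auto
    also have "\<dots> \<in> Idl (U (m + Suc n))"
    proof (intro ideal_finsum_closed genideal_ideal Uc)
      fix v assume v: "v \<in> V"
      have vS: "v \<in> S" using v V(2) by blast
      have "?x [^] n \<otimes> monomial (sum_mset (add_mset v Y)) \<in> Idl (U (Suc m + n))"
        using Suc.prems v by (intro Suc.IH) auto
      then have "k v \<otimes> (?x [^] n \<otimes> monomial (sum_mset (add_mset v Y))) \<in> Idl (U (Suc m + n))"
        using k[OF v] by (rule ideal.I_l_closed[OF genideal_ideal[OF Uc]])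
      moreover have "monomial (sum_mset (add_mset v Y)) = monomial v \<otimes> monomial (sum_mset Y)"
        using vS VS[OF Suc.prems(1)] by (simp add: monomial_add)
      moreover have "k v \<otimes> (?x [^] n \<otimes> (monomial v \<otimes> monomial (sum_mset Y)))
          = ?x [^] n \<otimes> ((k v \<otimes> monomial v) \<otimes> monomial (sum_mset Y))"
        using k[OF v] xc vS Yc nat_pow_closed[OF xc, of n] monomial_closed[OF vS] by (simp only: m_ac m_closed)
      ultimately show "?x [^] n \<otimes> ((k v \<otimes> monomial v) \<otimes> monomial (sum_mset Y)) \<in> Idl (U (m + Suc n))"
        by simp
    qed
    finally show ?case .
  qed
  have reduce: "Idl (U (L + B)) \<subseteq> ?C"
  proof (intro genideal_minimal C subsetI)
    fix z assume "z \<in> U (L + B)"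
    then obtain Y where Y: "set_mset Y \<subseteq> V" "size Y = L + B" "z = monomial (sum_mset Y)"
      unfolding U_def by (auto simp: multisets_of_size_def)
    have "\<exists>v\<in>V. B \<le> count Y v"
    proof (rule ccontr)
      assume "\<not> (\<exists>v\<in>V. B \<le> count Y v)"
      then have "(\<Sum>v\<in>set_mset Y. count Y v) \<le> (\<Sum>v\<in>set_mset Y. B)"
        using Y(1) by (intro sum_mono) (auto simp: not_le intro: less_imp_le)
      also have "\<dots> \<le> card V * B" using card_mono[OF V(1) Y(1)] by simp
      finally show False using Y(2) B by (simp add: size_multiset_overloaded_eq L_def)
    qed
    then obtain v where v: "v \<in> V" "B \<le> count Y v" by blast
    define Y' where "Y' = Y - replicate_mset B v"
    have "replicate_mset B v \<subseteq># Y" using v(2) by (simp add: count_le_replicate_mset_subset_eq)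
    then have Ysplit: "Y = replicate_mset B v + Y'" unfolding Y'_def by simp
    have Y': "set_mset Y' \<subseteq> V" "size Y' = L" using Y(1,2) unfolding Ysplit by auto
    obtain G w where G: "set_mset G \<subseteq> M" "size G = a" "w \<in> S" "nat_multiple B v = sum_mset G + w"
      using mult[OF v(1)] by blast
    have "sum_mset Y = (sum_mset G + w) + sum_mset Y'"
      unfolding Ysplit G(4)[symmetric] by (simp add: nat_multiple_def)
    then have "z = monomial (sum_mset G) \<otimes> monomial w \<otimes> monomial (sum_mset Y')"
      using Y(3) G(3) sum_generators_in_S[OF G(1)] VS[OF Y'(1)] by (simp add: monomial_add)
    moreover have "monomial (sum_mset G) \<otimes> monomial w \<in> ideal_power R I a"
      using sum_generators_in_ideal_power[OF G(1)] G(2,3) by (intro ideal.I_r_closed[OF J]) auto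
    moreover have "monomial (sum_mset Y') \<in> U L" unfolding U_def using Y' by (auto simp: multisets_of_size_def)
    ultimately show "z \<in> ?C"
      using linear_combinationsI[of "U L" "\<lambda>_. ideal_power R I a" "\<lambda>u. u", OF Ufin J] Uc by blast
  qed
  show ?thesis
  proof (rule integral_if_faithful_module[OF J _ Ufin])
    show "?x [^] B \<in> carrier R" using xc by simp
    show "u \<in> carrier R" if "u \<in> U L" for u using that Uc by blast
    have "\<exists>Y. set_mset Y \<subseteq> V \<and> size Y = L"
    proof (cases "V = {}")
      case True
      then show ?thesis by (intro exI[of _ "{#}"]) (simp add: L_def)
    next
      case False
      then obtain v where "v \<in> V" by blast
      then show ?thesis by (intro exI[of _ "replicate_mset L v"]) auto
    qed
    then obtain Y where Y: "set_mset Y \<subseteq> V" "size Y = L" by blast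
    then have "monomial (sum_mset Y) \<in> U L" "monomial (sum_mset Y) \<noteq> \<zero>"
      using monomial_nonzero[OF VS] by (auto simp: U_def multisets_of_size_def)
    then show "\<exists>u\<in>U L. u \<noteq> \<zero>" by blast
    show "?x [^] B \<otimes> u \<in> ?C" if "u \<in> U L" for u
      using that step reduce by (auto simp: U_def multisets_of_size_def)
  qed
qed

text \<open>The monomials of \<open>x\<close> are sorted by \<open>exponent_dichotomy\<close>. Those in the second class have individual
exponents, which are replaced by common multiples before they are added.\<close>

theorem weak_closure_subset:
  assumes p: "Factorial_Ring.prime p" "has_characteristic R p" and s: "1 \<le> s"
  shows "weak_closure R p (real_of_rat s) I \<subseteq> tight_closure R p I <+>\<^bsub>R\<^esub> rational_power R I s"
proof
  fix x assume x: "x \<in> weak_closure R p (real_of_rat s) I"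
  then obtain f where f: "Poly_Mapping.keys f \<subseteq> S" "x = h f"
    using h_surj unfolding weak_closure_def by blast
  obtain a b :: nat where ab: "0 < b" "s = of_nat a / of_nat b"
  proof -
    obtain a' b' where q: "quotient_of s = (a', b')" by fastforce
    then have "0 < b'" "s = of_int a' / of_int b'" using quotient_of_denom_pos quotient_of_div by blast+
    moreover have "0 \<le> a'" using s calculation by (simp add: zero_le_divide_iff divide_simps split: if_splits)
    ultimately show ?thesis by (intro that[of "nat b'" "nat a'"]) auto
  qed
  have rs: "real_of_rat s = real a / real b" by (simp add: ab(2) of_rat_divide)
  let ?K = "Poly_Mapping.keys f" and ?k = "\<lambda>v. h (Poly_Mapping.single 0 (Poly_Mapping.lookup f v))"
  let ?t = "\<lambda>v. ?k v \<otimes> monomial v"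
  have kc: "?k v \<in> carrier R" for v by (intro h_closed) auto
  define V1 where "V1 = {v \<in> ?K. \<exists>N>0. \<exists>g\<in>M. \<exists>w\<in>S. nat_multiple N v = nat_multiple N g + w}"
  define V2 where "V2 = ?K - V1"
  have V: "V1 \<subseteq> S" "V2 \<subseteq> S" "finite V1" "finite V2" "V1 \<inter> V2 = {}" "?K = V1 \<union> V2"
    using f(1) unfolding V1_def V2_def by auto
  obtain u where u: "\<forall>v\<in>?K. \<forall>\<^sub>F e in sequentially. \<exists>G W. set_mset G \<subseteq> M \<and> set_mset W \<subseteq> A
    \<and> u + nat_multiple (p ^ e) v = sum_mset G + sum_mset W
    \<and> (size G = nat \<lceil>real a / real b * real (p ^ e)\<rceil> \<or> (\<exists>g. G = replicate_mset (p ^ e) g))"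
    using weak_closure_exponents[OF p f(1), of "real_of_rat s"] x unfolding f(2) rs by blast
  have "(\<Oplus>v\<in>V1. ?t v) \<in> tight_closure R p I"
  proof (intro tight_closure_finsum p I_ideal V)
    fix v assume v: "v \<in> V1"
    then have "v \<in> S" using V(1) by blast
    then have "monomial v \<in> tight_closure R p I"
      using v monomial_in_tight_closure unfolding V1_def by blast
    then show "?t v \<in> tight_closure R p I" by (intro tight_closure_l_closed I_ideal kc)
  qed
  moreover have "(\<Oplus>v\<in>V2. ?t v) \<in> rational_power R I s"
  proof -
    have "\<exists>N>0. \<exists>G w. set_mset G \<subseteq> M \<and> size G = a * N \<and> w \<in> S \<and> nat_multiple (b * N) v = sum_mset G + w"
      if "v \<in> V2" for v
      using exponent_dichotomy[OF p(1) ab(1), of u v a] u that unfolding V1_def V2_def by blast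
    then obtain N where N: "\<And>v. v \<in> V2 \<Longrightarrow> 0 < N v \<and> (\<exists>G w. set_mset G \<subseteq> M \<and> size G = a * N v \<and> w \<in> S
        \<and> nat_multiple (b * N v) v = sum_mset G + w)"
      by metis
    let ?P = "\<Prod>v\<in>V2. N v"
    have P: "0 < ?P" using N by (simp add: prod_pos)
    have "(\<Oplus>v\<in>V2. ?t v) [^] (b * ?P) \<in> integral_closure R (ideal_power R I (a * ?P))"
    proof (rule sum_in_rational_power[OF V(4,2)])
      show "0 < b * ?P" using ab(1) P by simp
      fix v assume v: "v \<in> V2"
      obtain G w where G: "set_mset G \<subseteq> M" "size G = a * N v" "w \<in> S"
        "nat_multiple (b * N v) v = sum_mset G + w" using N[OF v] by blast
      let ?m = "\<Prod>v\<in>V2 - {v}. N v"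
      have m: "?P = ?m * N v" using v V(4) by (simp add: prod.remove mult.commute)
      have "b * ?P = ?m * (b * N v)" unfolding m by (simp add: mult_ac)
      then have "nat_multiple (b * ?P) v = nat_multiple ?m (sum_mset G + w)"
        using G(4) by (simp only: nat_multiple_mult)
      also have "\<dots> = sum_mset (repeat_mset ?m G) + nat_multiple ?m w"
        by (simp add: nat_multiple_add nat_multiple_sum_mset)
      finally have eq: "nat_multiple (b * ?P) v = sum_mset (repeat_mset ?m G) + nat_multiple ?m w" .
      have repeat: "set_mset (repeat_mset n G) \<subseteq> set_mset G" for n by (induction n) auto
      show "\<exists>G w. set_mset G \<subseteq> M \<and> size G = a * ?P \<and> w \<in> S \<and> nat_multiple (b * ?P) v = sum_mset G + w"
        using G(1-3) m repeat[of ?m] eq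
        by (intro exI[of _ "repeat_mset ?m G"] exI[of _ "nat_multiple ?m w"] conjI) auto
    qed (rule kc)
    moreover have "s = of_nat (a * ?P) / of_nat (b * ?P)" using ab P by (simp add: of_nat_mult del: of_nat_prod)
    moreover have "(\<Oplus>v\<in>V2. ?t v) \<in> carrier R" using V(2) kc by (intro finsum_closed) auto
    moreover have "0 < b * ?P" using ab(1) P by simp
    ultimately show ?thesis unfolding rational_power_def by blast
  qed
  moreover have "x = (\<Oplus>v\<in>V1. ?t v) \<oplus> (\<Oplus>v\<in>V2. ?t v)"
    unfolding f(2) h_eq_sum_monomials[OF f(1)] unfolding V(6)
    using V kc by (intro finsum_Un_disjoint) auto
  ultimately show "x \<in> tight_closure R p I <+>\<^bsub>R\<^esub> rational_power R I s"
    unfolding set_add_def' by blast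
qed

end

section \<open>Polynomial rings and affine semigroup rings\<close>

lemma affine_semigroup_generated:
  assumes "affine_semigroup n S"
  shows "\<exists>A. finite A \<and> S = {sum_mset W | W. set_mset W \<subseteq> A}"
proof -
  obtain A where A: "finite A" "S = additive_submonoid hull A"
    using assms unfolding affine_semigroup_def by blast
  let ?T = "{sum_mset W | W. set_mset W \<subseteq> A}"
  have "additive_submonoid ?T"
    unfolding additive_submonoid_def
  proof (intro conjI ballI)
    show "0 \<in> ?T" by (intro CollectI exI[of _ "{#}"]) simp
    fix u v assume "u \<in> ?T" "v \<in> ?T"
    then obtain U V where "u = sum_mset U" "v = sum_mset V" "set_mset U \<subseteq> A" "set_mset V \<subseteq> A" by blast
    then show "u + v \<in> ?T" by (intro CollectI exI[of _ "U + V"]) simp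
  qed
  moreover have "A \<subseteq> ?T"
  proof
    fix a assume "a \<in> A"
    then show "a \<in> ?T" by (intro CollectI exI[of _ "{#a#}"]) simp
  qed
  ultimately have "S \<subseteq> ?T" unfolding A(2) by (simp add: hull_minimal)
  moreover have "?T \<subseteq> S"
  proof
    fix v assume "v \<in> ?T"
    then obtain W where W: "v = sum_mset W" "set_mset W \<subseteq> A" by blast
    have "sum_mset W \<in> T" if T: "additive_submonoid T" "A \<subseteq> T" for T
      using W(2) T by (induction W) (auto simp: additive_submonoid_def)
    then show "v \<in> S" unfolding A(2) W(1) hull_def by blast
  qed
  ultimately show ?thesis using A(1) by blast
qed

text \<open>A polynomial ring is thus treated as a semigroup ring with finitely many generators.\<close>

lemma coordinate_vectors_generated:
  "(coordinate_vectors n :: (nat \<Rightarrow>\<^sub>0 nat) set)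
    = {sum_mset W | W. set_mset W \<subseteq> (\<lambda>i. Poly_Mapping.single i 1) ` {..<n}}" (is "_ = ?T")
proof
  let ?A = "(\<lambda>i. Poly_Mapping.single i 1) ` {..<n} :: (nat \<Rightarrow>\<^sub>0 nat) set"
  show "?T \<subseteq> coordinate_vectors n"
  proof
    fix v assume "v \<in> ?T"
    then obtain W where W: "v = sum_mset W" "set_mset W \<subseteq> ?A" by blast
    have "Poly_Mapping.keys (sum_mset W) \<subseteq> {..<n}"
      using W(2)
    proof (induction W)
      case (add w W)
      then show ?case using keys_add[of w "sum_mset W"] by fastforce
    qed simp
    then show "v \<in> coordinate_vectors n" by (simp add: W(1) coordinate_vectors_def)
  qed
  show "coordinate_vectors n \<subseteq> ?T"
  proof
    fix v :: "nat \<Rightarrow>\<^sub>0 nat" assume v: "v \<in> coordinate_vectors n"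
    let ?W = "\<Sum>i\<in>Poly_Mapping.keys v. replicate_mset (Poly_Mapping.lookup v i) (Poly_Mapping.single i (1::nat))"
    have rep: "sum_mset (replicate_mset k (Poly_Mapping.single i (1::nat))) = Poly_Mapping.single i k" for i k :: nat
      by (induction k) (auto simp: single_add[symmetric])
    have "sum_mset (\<Sum>i\<in>F. replicate_mset (Poly_Mapping.lookup v i) (Poly_Mapping.single i (1::nat)))
      = (\<Sum>i\<in>F. Poly_Mapping.single i (Poly_Mapping.lookup v i))" if "finite F" for F
      using that by (induction F rule: finite_induct) (simp_all add: rep del: sum_mset_replicate_mset One_nat_def)
    then have "sum_mset ?W = (\<Sum>i\<in>Poly_Mapping.keys v. Poly_Mapping.single i (Poly_Mapping.lookup v i))" by simp
    also have "\<dots> = v"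
      by (rule poly_mapping_eqI) (auto simp: lookup_sum lookup_single when_def in_keys_iff)
    finally have "v = sum_mset ?W" by simp
    moreover have "set_mset ?W \<subseteq> ?A"
      using v by (auto simp: coordinate_vectors_def set_mset_sum split: if_splits)
    ultimately show "v \<in> ?T" by blast
  qed
qed

lemma closures_eq_for_monomial_ideal:
  fixes R :: "('a, 'm) ring_scheme" and S :: "'g::{ordered_cancel_comm_monoid_add, linorder} set"
    and h :: "('g \<Rightarrow>\<^sub>0 'k::field) \<Rightarrow> 'a"
  assumes R: "cring R" "noetherian_ring R"
    and p: "Factorial_Ring.prime p" "has_characteristic R p"
    and I: "ideal I R" and s: "1 \<le> s"
    and A: "finite A" "S = {sum_mset W | W. set_mset W \<subseteq> A}"
    and h: "h \<in> ring_iso (semigroup_ring S) R" and mono: "monomial_ideal R S h I"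
  shows "tight_closure R p I <+>\<^bsub>R\<^esub> rational_power R I s = weak_closure R p (real_of_rat s) I"
proof -
  interpret noetherian_cring R using R by (simp add: noetherian_cring_def)
  interpret semigroup_presentation R A S h
    using A h by unfold_locales
  obtain M where M: "M \<subseteq> S" "I = Idl\<^bsub>R\<^esub> (monomial ` M)"
    using mono unfolding monomial_ideal_def monomial_def by blast
  have "monomial ` M \<subseteq> carrier R" using M(1) by auto
  then obtain C where C: "C \<subseteq> monomial ` M" "finite C" "Idl\<^bsub>R\<^esub> C = I"
    using finite_subset_generates[of "monomial ` M"] M(2) by metis
  then obtain M' where M': "M' \<subseteq> M" "finite M'" "C = monomial ` M'" by (meson finite_subset_image)
  interpret monomial_ideal_presentation R A S h I M'
    using M' M(1) C(3) by unfold_locales auto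
  show ?thesis
    using weak_closure_subset[OF p s] tight_closure_rational_power_subset_weak_closure[OF p I s] by blast
qed

theorem mainTheorem3:
  fixes R :: "('a, 'm) ring_scheme" and p :: nat and I :: "'a set" and s :: rat
  assumes "cring R" and "noetherian_ring R"
    and "Factorial_Ring.prime p" and "has_characteristic R p"
    and "ideal I R" and "1 \<le> s"
  shows "tight_closure R p I <+>\<^bsub>R\<^esub> rational_power R I s \<subseteq> weak_closure R p (real_of_rat s) I
    \<and> (\<forall>n (h :: ((nat \<Rightarrow>\<^sub>0 nat) \<Rightarrow>\<^sub>0 'k::field) \<Rightarrow> 'a).
         h \<in> ring_iso (semigroup_ring (coordinate_vectors n)) R \<longrightarrow>
         monomial_ideal R (coordinate_vectors n) h I \<longrightarrow>
         tight_closure R p I <+>\<^bsub>R\<^esub> rational_power R I s = weak_closure R p (real_of_rat s) I)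
    \<and> (\<forall>n S (h :: ((nat \<Rightarrow>\<^sub>0 int) \<Rightarrow>\<^sub>0 'k) \<Rightarrow> 'a).
         affine_semigroup n S \<longrightarrow>
         h \<in> ring_iso (semigroup_ring S) R \<longrightarrow>
         monomial_ideal R S h I \<longrightarrow>
         tight_closure R p I <+>\<^bsub>R\<^esub> rational_power R I s = weak_closure R p (real_of_rat s) I)"
proof (intro conjI allI impI)
  interpret noetherian_cring R using assms(1,2) by (simp add: noetherian_cring_def)
  show "tight_closure R p I <+>\<^bsub>R\<^esub> rational_power R I s \<subseteq> weak_closure R p (real_of_rat s) I"
    using assms(3-6) by (rule tight_closure_rational_power_subset_weak_closure)
next
  fix n and h :: "((nat \<Rightarrow>\<^sub>0 nat) \<Rightarrow>\<^sub>0 'k) \<Rightarrow> 'a"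
  assume "h \<in> ring_iso (semigroup_ring (coordinate_vectors n)) R"
    and "monomial_ideal R (coordinate_vectors n) h I"
  then show "tight_closure R p I <+>\<^bsub>R\<^esub> rational_power R I s = weak_closure R p (real_of_rat s) I"
    by (intro closures_eq_for_monomial_ideal[OF assms _ coordinate_vectors_generated]) auto
next
  fix n S and h :: "((nat \<Rightarrow>\<^sub>0 int) \<Rightarrow>\<^sub>0 'k) \<Rightarrow> 'a"
  assume S: "affine_semigroup n S"
    and h: "h \<in> ring_iso (semigroup_ring S) R" "monomial_ideal R S h I"
  obtain A where "finite A" "S = {sum_mset W | W. set_mset W \<subseteq> A}"
    using affine_semigroup_generated[OF S] by blast
  then show "tight_closure R p I <+>\<^bsub>R\<^esub> rational_power R I s = weak_closure R p (real_of_rat s) I"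
    using h by (intro closures_eq_for_monomial_ideal[OF assms]) auto
qed

end
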